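(* For every integer $k\geq 3$, the odd graph $O_k=K(2k+1,k)$ has a Hamilton cycle.
   Context: For integers $k\geq 1$ and $n\geq 2k+1$, the Kneser graph $K(n,k)$ is the graph whose vertices are the $k$-element subsets of $[n]=\{1,\ldots,n\}$, two subsets being adjacent if and only if they are disjoint. The odd graph is $O_k:=K(2k+1,k)$. *)

theory Defs
  imports "Graph_Theory.Pair_Digraph"
begin

(* An undirected simple graph is a pair_graph: a finite loop-free digraph with symmetric arc set. *)

definition kneser_graph :: "nat \<Rightarrow> nat \<Rightarrow> nat set pair_pre_digraph" where
  "kneser_graph n k =
     \<lparr> pverts = {A. A \<subseteq> {1..n} \<and> card A = k},
       parcs = {(A, B). A \<subseteq> {1..n} \<and> card A = k \<and> B \<subseteq> {1..n} \<and> card B = k \<and> A \<inter> B = {}} \<rparr>"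

definition odd_graph :: "nat \<Rightarrow> nat set pair_pre_digraph" where
  "odd_graph k = kneser_graph (2 * k + 1) k"

(* In a symmetric digraph, cycle also admits u, v, u, which traverses one undirected edge
   back and forth; the bound on the length excludes this. The vertices visited by a closed
   walk are the tails of its arcs. *)
definition (in pre_digraph) hamilton_cycle :: "'b awalk \<Rightarrow> bool" where
  "hamilton_cycle p \<longleftrightarrow> cycle p \<and> 3 \<le> length p \<and> tail G ` set p = verts G"

lemma pair_graph_kneser_graph:
  assumes "k \<ge> 1"
  shows "pair_graph (kneser_graph n k)"
proof
  let ?V = "{A. A \<subseteq> {1..n} \<and> card A = k}"
  have V: "pverts (kneser_graph n k) = ?V"
    by (simp add: kneser_graph_def)
  have arcs: "e \<in> parcs (kneser_graph n k) \<longleftrightarrow>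
      fst e \<in> ?V \<and> snd e \<in> ?V \<and> fst e \<inter> snd e = {}" for e
    unfolding kneser_graph_def by (cases e) simp
  have fin: "finite ?V"
    by (rule finite_subset[of _ "Pow {1..n}"]) blast+
  show "finite (pverts (kneser_graph n k))"
    unfolding V by (rule fin)
  have "parcs (kneser_graph n k) \<subseteq> ?V \<times> ?V"
    by (rule subsetI) (simp only: arcs mem_Times_iff)
  then show "finite (parcs (kneser_graph n k))"
    by (rule finite_subset) (rule finite_cartesian_product[OF fin fin])
  have "sym (parcs (kneser_graph n k))"
    by (rule symI) (simp add: arcs Int_commute)
  then show "symmetric (with_proj (kneser_graph n k))"
    by (simp add: symmetric_def)
  show "fst e \<in> pverts (kneser_graph n k)" if "e \<in> parcs (kneser_graph n k)" for e
    using that unfolding arcs V by (elim conjE)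
  show "snd e \<in> pverts (kneser_graph n k)" if "e \<in> parcs (kneser_graph n k)" for e
    using that unfolding arcs V by (elim conjE)
  show "fst e \<noteq> snd e" if "e \<in> parcs (kneser_graph n k)" for e
  proof
    assume "fst e = snd e"
    with that have "snd e = {}"
      unfolding arcs by simp
    moreover have "card (snd e) = k"
      using that unfolding arcs by simp
    ultimately show False
      using assms by simp
  qed
qed

end

theory Submission
  imports Defs "Graph_Theory.Vertex_Walk"
begin

text \<open>
  A vertex of the odd graph is encoded by a 0/1-word of length \<open>2k\<close> with \<open>k\<close> or \<open>k + 1\<close> ones: drop the
  element \<open>2k + 1\<close> from the ground set, and complement if it belonged to the vertex. The graph becomes
  the bipartite graph between two levels of the hypercube, together with the edges between
  complementary words of weight \<open>k\<close>.

  Every Dyck word is joined to its complement by a recursively defined path of \<open>2k + 1\<close> words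
  (\<open>states\<close>). These paths partition the two levels, so closing each of them by the edge between
  complementary words gives a 2-factor, whose cycles are indexed by binary trees with \<open>k\<close> nodes.

  An alternating 6-cycle (8-cycle) of the graph that shares every second edge with three (four) different
  cycles glues these into one. Alternating cycles for trees \<open>w\<close>, and for trees \<open>v\<close>, carry over to the trees
  \<open>Nd w v\<close>, since the path of \<open>Nd w v\<close> contains copies of the paths of \<open>w\<close> and of \<open>v\<close>. By induction this
  glues all cycles with the same size of \<open>w\<close>, and it remains to glue these classes. The 6-cycles that do
  this consume the components two at a time; therefore the induction runs simultaneously over
  gluings into one cycle and gluings into two cycles that separate two prescribed trees. Only the two
  trees of size 2 cannot be glued.
\<close>

section \<open>A partition of the two levels into paths\<close>

datatype dtree = Lf | Nd dtree dtree

fun sz :: "dtree \<Rightarrow> nat" where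
  "sz Lf = 0"
| "sz (Nd w v) = Suc (sz w + sz v)"

definition rc :: "bool list \<Rightarrow> bool list" where
  "rc y = rev (map Not y)"

text \<open>The left subtree is stored reversed and complemented, because the path of a tree traverses its left
  subtree backwards; the trees of size \<open>m\<close> still represent each Dyck word of length \<open>2m\<close> once.\<close>
fun word :: "dtree \<Rightarrow> bool list" where
  "word Lf = []"
| "word (Nd w v) = True # rc (word w) @ False # word v"

text \<open>The three parts meet in single flips. The head and the first word of the left block
  differ only in the \<open>False\<close> before \<open>word v\<close>; the left block ends in
  \<open>True # rev (word w) @ True # word v\<close>, and flipping its first letter starts the right
  block.\<close>

fun states :: "dtree \<Rightarrow> bool list list" where
  "states Lf = [[]]"
| "states (Nd w v) = word (Nd w v) #
     map (\<lambda>y. True # rc y @ True # word v) (states w) @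
     map (\<lambda>y. False # rev (word w) @ True # y) (states v)"

definition st :: "dtree \<Rightarrow> nat \<Rightarrow> bool list" where
  "st t j = states t ! j"

lemma Not_comp_Not [simp]: "Not \<circ> Not = id"
  by auto

lemma rc_simps [simp]:
  "rc [] = []" "rc (x # y) = rc y @ [\<not> x]" "rc (y @ z) = rc z @ rc y"
  "length (rc y) = length y" "rc (rc y) = y" "map Not (rc y) = rev y"
  "rc (map Not y) = rev y" "rc (rev y) = map Not y"
  by (simp_all add: rc_def rev_map)

lemma length_states [simp]: "length (states t) = Suc (2 * sz t)"
  by (induction t) auto

lemma length_word [simp]: "length (word t) = 2 * sz t"
  by (induction t) auto

lemma states_0 [simp]: "states t ! 0 = word t"
  by (cases t) auto

lemma st_0 [simp]: "st t 0 = word t"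
  by (simp add: st_def)

lemma st_W: "j \<le> 2 * sz w \<Longrightarrow> st (Nd w v) (Suc j) = True # rc (st w j) @ True # word v"
  by (simp add: st_def nth_append)

lemma st_V: "j \<le> 2 * sz v \<Longrightarrow>
    st (Nd w v) (2 * sz w + 2 + j) = False # rev (word w) @ True # st v j"
  by (simp add: st_def nth_append)

lemma st_cases:
  assumes "j \<le> 2 * sz (Nd w v)"
  obtains (zero) "j = 0"
  | (W) i where "j = Suc i" "i \<le> 2 * sz w"
  | (V) i where "j = 2 * sz w + 2 + i" "i \<le> 2 * sz v"
proof -
  consider "j = 0" | "0 < j" "j \<le> Suc (2 * sz w)" | "2 * sz w + 2 \<le> j" by linarith
  then show thesis
  proof cases
    case 2
    then show ?thesis using W[of "j - 1"] by simp
  next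
    case 3
    then show ?thesis using V[of "j - (2 * sz w + 2)"] assms by simp
  qed (rule zero)
qed

text \<open>Because \<open>map Not (rc y) = rev y\<close>, the right block ends in the complement of
  the head. This supplies the edge between complementary words that closes the path to a
  cycle.\<close>

lemma st_last: "st t (2 * sz t) = map Not (word t)"
proof (induction t)
  case (Nd w v)
  have "st (Nd w v) (2 * sz w + 2 + 2 * sz v) = False # rev (word w) @ True # map Not (word v)"
    using Nd.IH by (subst st_V) simp_all
  then show ?case by (simp add: algebra_simps)
qed (simp add: st_def)

lemma length_st: "j \<le> 2 * sz t \<Longrightarrow> length (st t j) = 2 * sz t"
proof (induction t arbitrary: j)
  case (Nd w v)
  from Nd.prems show ?case
    by (cases rule: st_cases) (use Nd.IH in \<open>simp_all add: st_W st_V del: add_2_eq_Suc'\<close>)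
qed (simp add: st_def)

section \<open>Heights and Dyck words\<close>

definition ht :: "bool list \<Rightarrow> int" where
  "ht y = (\<Sum>x\<leftarrow>y. if x then 1 else - 1)"

lemma ht_simps [simp]:
  "ht [] = 0" "ht (x # y) = (if x then 1 else - 1) + ht y" "ht (y @ z) = ht y + ht z"
  by (simp_all add: ht_def)

lemma ht_rev [simp]: "ht (rev y) = ht y"
  by (induction y) auto

lemma ht_Not [simp]: "ht (map Not y) = - ht y"
  by (induction y) auto

lemma ht_rc [simp]: "ht (rc y) = - ht y"
  by (simp add: rc_def)

lemma ht_word [simp]: "ht (word t) = 0"
  by (induction t) auto

text \<open>In the left block a height \<open>h\<close> becomes \<open>2 - h\<close>, which agrees
  with the shift of the position by one; in the right block both height and parity of the position
  are kept.\<close>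

lemma ht_st: "j \<le> 2 * sz t \<Longrightarrow> ht (st t j) = (if even j then 0 else 2)"
proof (induction t arbitrary: j)
  case (Nd w v)
  from Nd.prems show ?case
    by (cases rule: st_cases) (use Nd.IH in \<open>simp_all add: st_W st_V del: add_2_eq_Suc'\<close>)
qed (simp add: st_def)

definition dyck :: "bool list \<Rightarrow> bool" where
  "dyck y \<longleftrightarrow> ht y = 0 \<and> (\<forall>p q. y = p @ q \<longrightarrow> 0 \<le> ht p)"

lemma dyck_prefix: "dyck (p @ q) \<Longrightarrow> 0 \<le> ht p"
  by (auto simp: dyck_def)

text \<open>Since the total height is 0, the prefix \<open>p\<close> of \<open>rc y\<close> has the
  same height as the prefix \<open>rc q\<close> of \<open>y\<close>.\<close>

lemma dyck_rc: "dyck y \<Longrightarrow> dyck (rc y)"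
  unfolding dyck_def
proof (intro conjI allI impI)
  assume y: "ht y = 0 \<and> (\<forall>p q. y = p @ q \<longrightarrow> 0 \<le> ht p)"
  then show "ht (rc y) = 0" by simp
  fix p q assume "rc y = p @ q"
  then have "y = rc q @ rc p" by (metis rc_simps(3,5))
  with y have "0 \<le> ht (rc q)" "ht (rc q @ rc p) = 0" by blast+
  then show "0 \<le> ht p" by simp
qed

lemma dyck_word: "dyck (word t)"
proof (induction t)
  case (Nd w v)
  have w: "dyck (rc (word w))" by (rule dyck_rc) (rule Nd.IH)
  show ?case unfolding dyck_def
  proof (intro conjI allI impI)
    fix p q assume *: "word (Nd w v) = p @ q"
    show "0 \<le> ht p"
    proof (cases p)
      case (Cons x p')
      with * have x: "x" and "rc (word w) @ False # word v = p' @ q" by auto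
      then consider r where "rc (word w) = p' @ r" | r where "p' = rc (word w) @ r" "False # word v = r @ q"
        by (metis append_eq_append_conv2)
      then show ?thesis
      proof cases
        case 1
        then have "0 \<le> ht p'" using w dyck_prefix by metis
        then show ?thesis using Cons x by simp
      next
        case 2
        show ?thesis
        proof (cases r)
          case Nil
          then show ?thesis using 2 Cons x by simp
        next
          case (Cons x' r')
          then have "0 \<le> ht r'" "\<not> x'" using 2 dyck_prefix Nd.IH(2) by auto
          then show ?thesis using 2 Cons \<open>p = x # p'\<close> x by simp
        qed
      qed
    qed simp
  qed simp
qed (simp add: dyck_def)

text \<open>In a shortest prefix of positive height the last letter is an up-step, and everything
  before it stays at or below height 0. The induction descends to such a prefix.\<close>

lemma first_up:
  assumes "r = p @ q" "1 \<le> ht p"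
  shows "\<exists>a b. r = a @ True # b \<and> ht a = 0 \<and> (\<forall>p q. a = p @ q \<longrightarrow> ht p \<le> 0)"
  using assms
proof (induction p arbitrary: q rule: length_induct)
  case (1 p)
  show ?case
  proof (cases "\<exists>p' x s. p = p' @ x # s \<and> 1 \<le> ht p'")
    case True
    then obtain p' x s where "p = p' @ x # s" "1 \<le> ht p'" by blast
    moreover from this have "length p' < length p" "r = p' @ (x # s @ q)" using 1(2) by simp_all
    ultimately show ?thesis using 1(1) by blast
  next
    case False
    have "p \<noteq> []" using 1(3) by auto
    then obtain a x where p: "p = a @ [x]" by (metis rev_exhaust)
    have a: "ht a' \<le> 0" if "a = a' @ s" for a' s
    proof -
      have "\<exists>x s'. p = a' @ x # s'" using that p by (cases s) auto
      then show ?thesis using False by force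
    qed
    from a[of a "[]"] 1(3) p have "x" "ht a = 0" by (auto split: if_splits)
    with p a show ?thesis using 1(2) by auto
  qed
qed

text \<open>With total height 0, a suffix has the negated height of the prefix before it.\<close>

lemma dyck_rev_iff: "dyck (rev y) \<longleftrightarrow> ht y = 0 \<and> (\<forall>p q. y = p @ q \<longrightarrow> ht p \<le> 0)"
proof
  assume d: "dyck (rev y)"
  show "ht y = 0 \<and> (\<forall>p q. y = p @ q \<longrightarrow> ht p \<le> 0)"
  proof (intro conjI allI impI)
    show "ht y = 0" using d by (simp add: dyck_def)
    fix p q assume y: "y = p @ q"
    then have "0 \<le> ht (rev q)" using d dyck_prefix[of "rev q" "rev p"] by simp
    moreover have "ht (rev y) = 0" using d by (simp add: dyck_def)
    ultimately show "ht p \<le> 0" using y by simp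
  qed
next
  assume y: "ht y = 0 \<and> (\<forall>p q. y = p @ q \<longrightarrow> ht p \<le> 0)"
  show "dyck (rev y)" unfolding dyck_def
  proof (intro conjI allI impI)
    fix p q assume "rev y = p @ q"
    then have yy: "y = rev q @ rev p" by (metis rev_append rev_rev_ident)
    then have "ht (rev q) \<le> 0" using y by blast
    then show "0 \<le> ht p" using y yy by simp
  qed (use y in simp)
qed

text \<open>This is the first-return decomposition of Dyck words. The return is found by applying
  \<open>first_up\<close> to the complement of the tail; \<open>rev a\<close> then encodes the left
  subtree.\<close>

lemma word_surj: "dyck y \<Longrightarrow> \<exists>t. word t = y"
proof (induction y rule: length_induct)
  case (1 y)
  show ?case
  proof (cases y)
    case Nil
    then show ?thesis by (intro exI[of _ Lf]) simp
  next
    case (Cons x r)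
    have x: "x" using dyck_prefix[of "[x]" r] 1(2) Cons by (auto split: if_splits)
    have "ht y = 0" using 1(2) by (simp add: dyck_def)
    then have "1 \<le> ht (map Not r)" using Cons x by simp
    then obtain a b where ab: "map Not r = a @ True # b" "ht a = 0"
      "\<forall>p q. a = p @ q \<longrightarrow> ht p \<le> 0" using first_up[of "map Not r" "map Not r" "[]"] by auto
    have "r = map Not (map Not r)" by simp
    also have "\<dots> = map Not a @ False # map Not b" unfolding ab(1) by simp
    finally have r: "r = map Not a @ False # map Not b" .
    have "dyck (rev a)" using ab dyck_rev_iff by blast
    moreover have "length (rev a) < length y" "length (map Not b) < length y" using r Cons by auto
    moreover have "dyck (map Not b)" unfolding dyck_def
    proof (intro conjI allI impI)
      show "ht (map Not b) = 0" using \<open>ht y = 0\<close> Cons r x ab(2) by simp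
      fix p q assume "map Not b = p @ q"
      then have "y = (x # map Not a @ False # p) @ q" using Cons r by simp
      then have "0 \<le> ht (x # map Not a @ False # p)" using dyck_prefix 1(2) by metis
      then show "0 \<le> ht p" using ab x by simp
    qed
    ultimately obtain w v where "word w = rev a" "word v = map Not b" using 1(1) by metis
    then have "word (Nd w v) = y" using Cons r x by (simp add: rc_def rev_map)
    then show ?thesis by blast
  qed
qed

text \<open>If the two cuts differed, the longer Dyck word would have a prefix of height -1.\<close>

lemma split_down:
  assumes "a @ False # b = a' @ False # b'" "dyck a" "dyck a'"
  shows "a = a' \<and> b = b'"
proof -
  have *: False if "a' = a @ False # r" "dyck a" "dyck a'" for a a' r
  proof -
    have "0 \<le> ht (a @ [False])" using that dyck_prefix[of "a @ [False]" r] by simp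
    then show False using that by (simp add: dyck_def)
  qed
  from assms(1) obtain us where "a = a' @ us \<and> us @ False # b = False # b' \<or> a @ us = a' \<and> False # b = us @ False # b'"
    unfolding append_eq_append_conv2 by blast
  then show ?thesis
  proof
    assume us: "a = a' @ us \<and> us @ False # b = False # b'"
    show ?thesis
    proof (cases us)
      case (Cons x r)
      then show ?thesis using *[OF _ assms(3,2), of r] us by simp
    qed (use us in simp)
  next
    assume us: "a @ us = a' \<and> False # b = us @ False # b'"
    show ?thesis
    proof (cases us)
      case (Cons x r)
      then show ?thesis using *[OF _ assms(2,3), of r] us by auto
    qed (use us in simp)
  qed
qed

text \<open>Complementing every letter reduces this to \<open>split_down\<close>, because
  \<open>map Not (rev a)\<close> is \<open>rc a\<close> and hence Dyck.\<close>

lemma split_up: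
  assumes "rev a @ True # b = rev a' @ True # b'" "dyck a" "dyck a'"
  shows "a = a' \<and> b = b'"
proof -
  have d: "dyck (map Not (rev a))" if "dyck a" for a
    using dyck_rc[OF that] by (simp add: rc_def rev_map)
  have "map Not (rev a @ True # b) = map Not (rev a' @ True # b')" using assms(1) by (rule arg_cong)
  then have "map Not (rev a) @ False # map Not b = map Not (rev a') @ False # map Not b'" by simp
  from split_down[OF this d[OF assms(2)] d[OF assms(3)]]
  have "map Not (map Not (rev a)) = map Not (map Not (rev a'))" "map Not (map Not b) = map Not (map Not b')"
    by (auto simp del: map_map)
  then show ?thesis by simp
qed

lemma split_last_up:
  assumes "s @ True # v = s' @ True # v'" "dyck v" "dyck v'"
  shows "s = s' \<and> v = v'"
proof -
  have *: "rev (s @ True # v) = rev (s' @ True # v')" using assms(1) by (rule arg_cong)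
  then have "rev v @ True # rev s = rev v' @ True # rev s'" by simp
  from split_up[OF this assms(2,3)] show ?thesis by simp
qed

text \<open>The word reveals its part of the path: the head is Dyck, the left block starts with
  \<open>True\<close> but is not Dyck, the right block starts with \<open>False\<close>. Within each
  part the cutting position is determined by one of the splitting lemmas.\<close>

lemma st_inj:
  assumes "st t i = st t' j" "i \<le> 2 * sz t" "j \<le> 2 * sz t'"
  shows "t = t' \<and> i = j"
  using assms
proof (induction t arbitrary: t' i j)
  case Lf
  then have "length (st t' j) = 0" by (simp add: st_def)
  then have "sz t' = 0" using length_st[of j t'] Lf by simp
  then show ?case using Lf by (cases t') auto
next
  case (Nd w v)
  have "sz t' = sz (Nd w v)" using length_st[of i "Nd w v"] length_st[of j t'] Nd.prems by simp
  then obtain w' v' where t': "t' = Nd w' v'" by (cases t') auto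
  \<comment> \<open>A word of the left block is not Dyck: if its total height is 0, the prefix
    before the \<open>True\<close> in front of \<open>word v\<close> has height -1.\<close>
  have *: False if "st (Nd w v) (Suc i) = word t'" "i \<le> 2 * sz w" for w v i t'
  proof -
    have "ht (True # rc (st w i) @ True # word v) = 0" using that by (metis ht_word st_W)
    then have "ht (rc (st w i)) = - 2" by simp
    moreover have "0 \<le> ht (True # rc (st w i))"
      using dyck_word[of t'] dyck_prefix[of "True # rc (st w i)" "True # word v"] that by (simp add: st_W)
    ultimately show False by simp
  qed
  note d = dyck_word dyck_rc[OF dyck_word]
  from Nd.prems(2) show ?case
  proof (cases rule: st_cases)
    case zero
    from Nd.prems(3)[unfolded t'] show ?thesis
    proof (cases rule: st_cases)
      case zero2: zero
      from Nd.prems(1) zero zero2 t' have "rc (word w) @ False # word v = rc (word w') @ False # word v'"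
        by simp
      from split_down[OF this d(2) d(2)] have "word w = word w'" "word v = word v'" by (metis rc_simps(5))+
      then show ?thesis using Nd.IH(1)[of 0 w' 0] Nd.IH(2)[of 0 v' 0] zero zero2 t' by simp
    next
      case (W i')
      then show ?thesis using *[of w' v' i' "Nd w v"] Nd.prems(1) zero t' by simp
    next
      case (V i')
      then show ?thesis using Nd.prems(1) zero t' st_V[of i' v' w'] by simp
    qed
  next
    case (W i')
    from Nd.prems(3)[unfolded t'] show ?thesis
    proof (cases rule: st_cases)
      case zero
      then show ?thesis using *[of w v i' "Nd w' v'"] Nd.prems(1) W t' by simp
    next
      case W2: (W i2)
      from Nd.prems(1) W W2 t' have "rc (st w i') @ True # word v = rc (st w' i2) @ True # word v'"
        by (simp add: st_W)
      from split_last_up[OF this d(1) d(1)] have "st w i' = st w' i2" "st v 0 = st v' 0"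
        by (metis rc_simps(5) st_0)+
      then show ?thesis using Nd.IH(1)[of i' w' i2] Nd.IH(2)[of 0 v' 0] W W2 t' by simp
    next
      case (V i2)
      then show ?thesis using Nd.prems(1) W t' st_V[of i2 v' w'] st_W[of i' w v] by simp
    qed
  next
    case (V i')
    from Nd.prems(3)[unfolded t'] show ?thesis
    proof (cases rule: st_cases)
      case zero
      then show ?thesis using Nd.prems(1) V t' st_V[of i' v w] by simp
    next
      case W2: (W i2)
      then show ?thesis using Nd.prems(1) V t' st_V[of i' v w] st_W[of i2 w' v'] by simp
    next
      case V2: (V i2)
      from Nd.prems(1) V V2 t' st_V[of i' v w] st_V[of i2 v' w']
      have "rev (word w) @ True # st v i' = rev (word w') @ True # st v' i2" by simp
      from split_up[OF this d(1) d(1)] have "st w 0 = st w' 0" "st v i' = st v' i2" by simp_all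
      then show ?thesis using Nd.IH(1)[of 0 w' 0] Nd.IH(2)[of i' v' i2] V V2 t' by simp
    qed
  qed
qed

text \<open>The cases mirror \<open>states\<close>: a Dyck word is a head, a first letter
  \<open>False\<close> leads to the right block, anything else to the left block. The remaining
  inner word again has height 0 or 2, so the induction applies to it.\<close>

lemma st_surj:
  assumes "ht y = 0 \<or> ht y = 2"
  shows "\<exists>t j. j \<le> 2 * sz t \<and> st t j = y"
  using assms
proof (induction y rule: length_induct)
  case (1 y)
  have IH: "\<exists>t j. j \<le> 2 * sz t \<and> st t j = z" if "length z < length y" "ht z = 0 \<or> ht z = 2" for z
    using 1(1) that by blast
  show ?case
  proof (cases "dyck y")
    case True
    then obtain t where "word t = y" using word_surj by blast
    then show ?thesis by (intro exI[of _ t] exI[of _ 0]) simp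
  next
    case nd: False
    then obtain x r where y: "y = x # r" by (cases y) (auto simp: dyck_def)
    show ?thesis
    proof (cases x)
      case False
      then have "1 \<le> ht r" using 1(2) y by auto
      then obtain a b where ab: "r = a @ True # b" "ht a = 0"
        "\<forall>p q. a = p @ q \<longrightarrow> ht p \<le> 0" using first_up[of r r "[]"] by auto
      then have "dyck (rev a)" using dyck_rev_iff by blast
      then obtain w where w: "word w = rev a" using word_surj by blast
      have "ht b = ht y" using y ab False by simp
      then obtain v j where v: "j \<le> 2 * sz v" "st v j = b" using IH[of b] 1(2) y ab by auto
      then have "st (Nd w v) (2 * sz w + 2 + j) = y" using w y ab False by (simp add: st_V del: add_2_eq_Suc')
      then show ?thesis using v by (intro exI[of _ "Nd w v"] exI[of _ "2 * sz w + 2 + j"]) simp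
    next
      case True
      \<comment> \<open>Read backwards, the tail rises above 0: for height 2 the whole tail has
        height 1, and for height 0 a prefix of negative height leaves a suffix of positive
        height.\<close>
      have "\<exists>p q. rev r = p @ q \<and> 1 \<le> ht p"
      proof (cases "ht y = 2")
        case t: True
        then show ?thesis using y True by (intro exI[of _ "rev r"] exI[of _ "[]"]) simp
      next
        case False
        then have "ht y = 0" using 1(2) by simp
        then obtain p q where pq: "y = p @ q" "ht p < 0" using nd by (auto simp: dyck_def not_le)
        then obtain p' where "p = x # p'" using y by (cases p) auto
        then have "rev r = rev q @ rev p'" "1 \<le> ht (rev q)" using y pq \<open>ht y = 0\<close> by auto
        then show ?thesis by blast
      qed
      then obtain a b where ab: "rev r = a @ True # b" "ht a = 0"
        "\<forall>p q. a = p @ q \<longrightarrow> ht p \<le> 0" using first_up[of "rev r"] by metis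
      then have "dyck (rev a)" using dyck_rev_iff by blast
      then obtain v where v: "word v = rev a" using word_surj by blast
      have r: "r = rev b @ True # rev a" using ab(1) by (metis append.assoc append_Cons append_Nil rev.simps(2) rev_append rev_rev_ident)
      have "ht (rc (rev b)) = 2 - ht y" using r y True ab(2) by simp
      then have "ht (rc (rev b)) = 0 \<or> ht (rc (rev b)) = 2" using 1(2) by auto
      then obtain w j where w: "j \<le> 2 * sz w" "st w j = rc (rev b)"
        using IH[of "rc (rev b)"] r y by (auto simp del: rc_simps(8))
      then have "st (Nd w v) (Suc j) = y" using v y r True by (simp add: st_W)
      then show ?thesis using w by (intro exI[of _ "Nd w v"] exI[of _ "Suc j"]) simp
    qed
  qed
qed

section \<open>Gluing cycles\<close>

definition up :: "bool list \<Rightarrow> bool list \<Rightarrow> bool" where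
  "up y z \<longleftrightarrow> (\<exists>p q. y = p @ False # q \<and> z = p @ True # q)"

lemma upI: "up (p @ False # q) (p @ True # q)"
  by (auto simp: up_def)

lemma up_append: "up y z \<Longrightarrow> up (a @ y @ b) (a @ z @ b)"
proof -
  assume "up y z"
  then obtain p q where "y = p @ False # q" "z = p @ True # q" by (auto simp: up_def)
  then show ?thesis using upI[of "a @ p" "q @ b"] by simp
qed

lemma up_Cons [simp]: "up (x # y) (x' # z) \<longleftrightarrow> x = x' \<and> up y z \<or> \<not> x \<and> x' \<and> y = z"
proof
  assume "up (x # y) (x' # z)"
  then obtain p q where pq: "x # y = p @ False # q" "x' # z = p @ True # q" by (auto simp: up_def)
  then show "x = x' \<and> up y z \<or> \<not> x \<and> x' \<and> y = z" by (cases p) (auto simp: up_def)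
next
  assume "x = x' \<and> up y z \<or> \<not> x \<and> x' \<and> y = z"
  then show "up (x # y) (x' # z)"
    using up_append[of y z "[x]" "[]"] upI[of "[]" y] by auto
qed

lemma up_same_prefix [simp]: "up (p @ y) (p @ z) \<longleftrightarrow> up y z"
  by (induction p) auto

lemma up_rc: "up y z \<Longrightarrow> up (rc z) (rc y)"
proof -
  assume "up y z"
  then obtain p q where "y = p @ False # q" "z = p @ True # q" by (auto simp: up_def)
  then show ?thesis using upI[of "rc q" "rc p"] by simp
qed

text \<open>The pair \<open>(t, j)\<close> stands for the path edge between \<open>st t j\<close>
  and \<open>st t (Suc j)\<close>. Even positions have height 0 and odd ones height 2, which decides
  which end is \<open>lower\<close>.\<close>

type_synonym tedge = "dtree \<times> nat"

definition lower :: "tedge \<Rightarrow> bool list" where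
  "lower e = st (fst e) (if even (snd e) then snd e else Suc (snd e))"

definition upper :: "tedge \<Rightarrow> bool list" where
  "upper e = st (fst e) (if even (snd e) then Suc (snd e) else snd e)"

definition valid_edge :: "tedge \<Rightarrow> bool" where
  "valid_edge e \<longleftrightarrow> snd e < 2 * sz (fst e)"

text \<open>A cyclic sequence of path edges, each feeding the next one, is an alternating cycle: it is traversed
  from the lower to the upper end of each path edge, and then along an edge outside the paths.\<close>
definition feeds :: "tedge \<Rightarrow> tedge \<Rightarrow> bool" where
  "feeds e f \<longleftrightarrow> up (lower f) (upper e)"

text \<open>\<open>inV\<close> and \<open>inW\<close> send a path edge of the right or left subtree
  to its copy in the path of the larger tree; the shifts are those of \<open>st_V\<close> and
  \<open>st_W\<close>.\<close>

definition inV :: "dtree \<Rightarrow> tedge \<Rightarrow> tedge" where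
  "inV w e = (Nd w (fst e), snd e + 2 * sz w + 2)"

definition inW :: "dtree \<Rightarrow> tedge \<Rightarrow> tedge" where
  "inW v e = (Nd (fst e) v, Suc (snd e))"

lemma fst_inV [simp]: "fst (inV w e) = Nd w (fst e)" and fst_inW [simp]: "fst (inW v e) = Nd (fst e) v"
  by (simp_all add: inV_def inW_def)

lemma inj_inV: "inj (inV w)"
  by (auto simp: inV_def inj_def prod_eq_iff)

lemma inj_inW: "inj (inW v)"
  by (auto simp: inW_def inj_def prod_eq_iff)

lemma valid_edge_inV: "valid_edge e \<Longrightarrow> valid_edge (inV w e)" and valid_edge_inW: "valid_edge e \<Longrightarrow> valid_edge (inW v e)"
  by (auto simp: valid_edge_def inV_def inW_def)

lemma lower_upper_inV:
  assumes "valid_edge e"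
  shows "lower (inV w e) = False # rev (word w) @ True # lower e"
    and "upper (inV w e) = False # rev (word w) @ True # upper e"
proof -
  obtain t j where e: "e = (t, j)" by (cases e)
  then have j: "j < 2 * sz t" using assms by (simp add: valid_edge_def)
  have "st (Nd w t) (j + 2 * sz w + 2) = False # rev (word w) @ True # st t j"
    "st (Nd w t) (Suc (j + 2 * sz w + 2)) = False # rev (word w) @ True # st t (Suc j)"
    using st_V[of j t w] st_V[of "Suc j" t w] j by (simp_all add: algebra_simps)
  then show "lower (inV w e) = False # rev (word w) @ True # lower e"
    "upper (inV w e) = False # rev (word w) @ True # upper e"
    by (simp_all add: e lower_def upper_def inV_def)
qed

lemma lower_upper_inW:
  assumes "valid_edge e"
  shows "lower (inW v e) = True # rc (upper e) @ True # word v"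
    and "upper (inW v e) = True # rc (lower e) @ True # word v"
proof -
  obtain t j where e: "e = (t, j)" by (cases e)
  then have j: "j < 2 * sz t" using assms by (simp add: valid_edge_def)
  then show "lower (inW v e) = True # rc (upper e) @ True # word v"
    "upper (inW v e) = True # rc (lower e) @ True # word v"
    by (auto simp: e lower_def upper_def inW_def st_W)
qed

lemma feeds_inV: "feeds e f \<Longrightarrow> valid_edge e \<Longrightarrow> valid_edge f \<Longrightarrow> feeds (inV w e) (inV w f)"
  by (simp add: feeds_def lower_upper_inV)

text \<open>The left subtree is complemented, so lower and upper ends change places and an
  alternating cycle is traversed in the opposite direction.\<close>

lemma feeds_inW: "feeds e f \<Longrightarrow> valid_edge e \<Longrightarrow> valid_edge f \<Longrightarrow> feeds (inW v f) (inW v e)"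
  using up_append[OF up_rc, of "lower f" "upper e" "[]" "True # word v"]
  by (simp add: feeds_def lower_upper_inW)

text \<open>The claim is \<open>feeds (t, j) (t, j)\<close>, so edges inside a block inherit it
  through \<open>feeds_inV\<close> and \<open>feeds_inW\<close>. Only the two seams between the
  three parts of the path need a direct check.\<close>

lemma up_lower_upper:
  assumes "j < 2 * sz t"
  shows "up (lower (t, j)) (upper (t, j))"
  using assms
proof (induction t arbitrary: j)
  case (Nd w v)
  then have "j \<le> 2 * sz (Nd w v)" by simp
  then show ?case
  proof (cases rule: st_cases)
    case zero
    then show ?thesis by (simp add: lower_def upper_def st_W)
  next
    case (W i)
    show ?thesis
    proof (cases "i = 2 * sz w")
      case True
      then show ?thesis using W st_V[of 0 v w] by (simp add: lower_def upper_def st_W st_last)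
    next
      case False
      then have i: "i < 2 * sz w" using W by simp
      from Nd.IH(1)[OF this] have "feeds (w, i) (w, i)" by (simp add: feeds_def)
      then have "feeds (inW v (w, i)) (inW v (w, i))" using i by (intro feeds_inW) (simp_all add: valid_edge_def)
      then show ?thesis using W by (simp add: feeds_def inW_def)
    qed
  next
    case (V i)
    then have i: "i < 2 * sz v" using Nd.prems by simp
    from Nd.IH(2)[OF this] have "feeds (v, i) (v, i)" by (simp add: feeds_def)
    then have "feeds (inV w (v, i)) (inV w (v, i))" using i by (intro feeds_inV) (simp_all add: valid_edge_def)
    then show ?thesis using V by (simp add: feeds_def inV_def algebra_simps)
  qed
qed simp

section \<open>Lists read as paths and as cycles\<close>

fun pedges :: "'a list \<Rightarrow> 'a set set" where
  "pedges (x # y # r) = insert {x, y} (pedges (y # r))"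
| "pedges [x] = {}"
| "pedges [] = {}"

definition cedges :: "'a list \<Rightarrow> 'a set set" where
  "cedges l = insert {last l, hd l} (pedges l)"

lemma pedges_append:
  "a \<noteq> [] \<Longrightarrow> b \<noteq> [] \<Longrightarrow> pedges (a @ b) = insert {last a, hd b} (pedges a \<union> pedges b)"
proof (induction a rule: pedges.induct)
  case (2 x)
  then show ?case by (cases b) auto
qed auto

lemma pedges_rev [simp]: "pedges (rev l) = pedges l"
proof (induction l rule: pedges.induct)
  case (1 x y r)
  have "pedges (rev (x # y # r)) = pedges ((rev r @ [y]) @ [x])" by simp
  also have "\<dots> = insert {y, x} (pedges (rev (y # r)))" by (subst pedges_append) auto
  finally show ?case using 1 by (simp add: insert_commute)
qed auto

lemma pedges_nth: "Suc j < length l \<Longrightarrow> {l ! j, l ! Suc j} \<in> pedges l"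
proof (induction l arbitrary: j rule: pedges.induct)
  case (1 x y r)
  then show ?case by (cases j) auto
qed auto

lemma pedges_memE:
  assumes "s \<in> pedges l"
  obtains a b where "l = a @ b" "a \<noteq> []" "b \<noteq> []" "s = {last a, hd b}"
  using assms
proof (induction l arbitrary: thesis rule: pedges.induct)
  case (1 x y r)
  show ?case
  proof (cases "s = {x, y}")
    case True
    then show ?thesis using 1(2)[of "[x]" "y # r"] by simp
  next
    case False
    then have "s \<in> pedges (y # r)" using 1 by simp
    then obtain a b where "y # r = a @ b" "a \<noteq> []" "b \<noteq> []" "s = {last a, hd b}" using 1(1) by blast
    then show ?thesis using 1(2)[of "x # a" b] by simp
  qed
qed auto

lemma pedges_conv_nth: "s \<in> pedges l \<Longrightarrow> \<exists>j. Suc j < length l \<and> s = {l ! j, l ! Suc j}"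
proof (induction l rule: pedges.induct)
  case (1 x y r)
  show ?case
  proof (cases "s = {x, y}")
    case True
    then show ?thesis by (intro exI[of _ 0]) simp
  next
    case False
    then obtain j where "Suc j < length (y # r)" "s = {(y # r) ! j, (y # r) ! Suc j}" using 1 by auto
    then show ?thesis by (intro exI[of _ "Suc j"]) simp
  qed
qed auto

lemma cedges_swap: "a \<noteq> [] \<Longrightarrow> b \<noteq> [] \<Longrightarrow> cedges (b @ a) = cedges (a @ b)"
  by (simp add: cedges_def pedges_append) blast

lemma cedges_rev: "cedges (rev l) = cedges l"
  by (cases "l = []") (simp_all add: cedges_def hd_rev last_rev insert_commute[of "hd l" "last l"])

text \<open>A rotation moves the given edge to the place between the last and the first entry; a
  reversal corrects its direction if necessary.\<close>

lemma cedges_open: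
  assumes "{p, q} \<in> cedges l" "l \<noteq> []"
  obtains l' where "l' \<noteq> []" "set l' = set l" "distinct l' = distinct l" "cedges l' = cedges l"
    "hd l' = p" "last l' = q"
proof -
  have "\<exists>l'. l' \<noteq> [] \<and> set l' = set l \<and> distinct l' = distinct l \<and> cedges l' = cedges l \<and>
      {hd l', last l'} = {p, q}"
  proof (cases "{p, q} = {last l, hd l}")
    case True
    then show ?thesis using assms by (intro exI[of _ l]) auto
  next
    case False
    then have "{p, q} \<in> pedges l" using assms by (simp add: cedges_def)
    then obtain a b where ab: "l = a @ b" "a \<noteq> []" "b \<noteq> []" "{p, q} = {last a, hd b}" by (rule pedges_memE)
    then show ?thesis by (intro exI[of _ "b @ a"]) (auto simp: cedges_swap)
  qed
  then obtain l' where l': "l' \<noteq> []" "set l' = set l" "distinct l' = distinct l" "cedges l' = cedges l"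
    "{hd l', last l'} = {p, q}" by blast
  then consider "hd l' = p" "last l' = q" | "hd l' = q" "last l' = p" by (auto simp: doubleton_eq_iff)
  then show thesis
  proof cases
    case 1
    then show ?thesis using that l' by blast
  next
    case 2
    then show ?thesis using that[of "rev l'"] l' by (simp add: cedges_rev hd_rev last_rev)
  qed
qed

text \<open>\<open>linked X U\<close> says that the cycles of the trees in \<open>X\<close> can be glued to a single cycle that still contains
  all their path edges except possibly those in \<open>U\<close>; \<open>linked_path X U e f\<close> is the analogue for a path
  from the lower end of \<open>e\<close> to the upper end of \<open>f\<close>.\<close>
inductive linked :: "dtree set \<Rightarrow> tedge set \<Rightarrow> bool"
  and linked_path :: "dtree set \<Rightarrow> tedge set \<Rightarrow> tedge \<Rightarrow> tedge \<Rightarrow> bool" where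
  linked_single: "linked {t} U"
| linked_path_start: "linked X U \<Longrightarrow> fst e \<in> X \<Longrightarrow> valid_edge e \<Longrightarrow> e \<notin> U \<Longrightarrow> linked_path X (insert e U) e e"
| linked_path_join: "linked_path X U e f \<Longrightarrow> linked_path X' U' e' f' \<Longrightarrow> X \<inter> X' = {} \<Longrightarrow> feeds f e' \<Longrightarrow>
    linked_path (X \<union> X') (U \<union> U') e f'"
| linked_close: "linked_path X U e f \<Longrightarrow> feeds f e \<Longrightarrow> U \<subseteq> U' \<Longrightarrow> linked X U'"

lemma linked_path_valid: "linked_path X U e f \<Longrightarrow> fst e \<in> X \<and> valid_edge e \<and> fst f \<in> X \<and> valid_edge f"
  by (induction rule: linked_linked_path.inducts(2)[where ?P1.0 = "\<lambda>_ _. True"]) auto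

lemma linked_path_mono:
  "linked X U \<Longrightarrow> U \<subseteq> V \<Longrightarrow> linked X V"
  "linked_path X U e f \<Longrightarrow> U \<subseteq> V \<Longrightarrow> linked_path X V e f"
proof (induction arbitrary: V and V rule: linked_linked_path.inducts)
  case (linked_single t U)
  show ?case by (rule linked_linked_path.linked_single)
next
  case (linked_path_start X U e)
  \<comment> \<open>\<open>V\<close> already contains \<open>e\<close>, so the cycle has to be
    opened at \<open>e\<close> starting from the smaller set \<open>V - {e}\<close>.\<close>
  have "U \<subseteq> V - {e}" using linked_path_start.prems linked_path_start.hyps by blast
  from linked_linked_path.linked_path_start[OF linked_path_start.IH[OF this] linked_path_start.hyps(2,3)]
  have "linked_path X (insert e (V - {e})) e e" by simp
  moreover have "insert e (V - {e}) = V" using linked_path_start.prems by blast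
  ultimately show ?case by simp
next
  case (linked_path_join X U e f X' U' e' f')
  have "linked_path (X \<union> X') (V \<union> V) e f'"
    by (rule linked_linked_path.linked_path_join[OF linked_path_join.IH(1) linked_path_join.IH(2) linked_path_join.hyps(3,4)]) (use linked_path_join.prems in blast)+
  then show ?case by simp
next
  case (linked_close X U e f U')
  show ?case by (rule linked_linked_path.linked_close[OF linked_close.hyps(1,2)]) (use linked_close in blast)
qed

lemmas linked_mono = linked_path_mono(1)

definition edges_of :: "dtree set \<Rightarrow> tedge set" where
  "edges_of X = {e. fst e \<in> X \<and> valid_edge e}"

text \<open>Gluing opens only path edges of the glued trees.\<close>

lemma linked_path_edges_of:
  "linked X U \<Longrightarrow> linked X (U \<inter> edges_of X)"
  "linked_path X U e f \<Longrightarrow> linked_path X (U \<inter> edges_of X) e f"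
proof (induction rule: linked_linked_path.inducts)
  case (linked_single t U)
  show ?case by (rule linked_linked_path.linked_single)
next
  case (linked_path_start X U e)
  then have "linked_path X (insert e (U \<inter> edges_of X)) e e" by (intro linked_linked_path.linked_path_start) auto
  then show ?case using linked_path_start by (simp add: edges_of_def Int_insert_left)
next
  case (linked_path_join X U e f X' U' e' f')
  then have "linked_path (X \<union> X') (U \<inter> edges_of X \<union> U' \<inter> edges_of X') e f'" by (intro linked_linked_path.linked_path_join) auto
  then show ?case by (rule linked_path_mono) (auto simp: edges_of_def)
next
  case (linked_close X U e f U')
  then show ?case by (intro linked_linked_path.linked_close[of X "U \<inter> edges_of X" e f]) auto
qed

lemma linked_path_inV:
  "linked X U \<Longrightarrow> linked (Nd w ` X) (inV w ` U)"
  "linked_path X U e f \<Longrightarrow> linked_path (Nd w ` X) (inV w ` U) (inV w e) (inV w f)"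
proof (induction rule: linked_linked_path.inducts)
  case (linked_single t U)
  show ?case by (simp add: linked_linked_path.linked_single)
next
  case (linked_path_start X U e)
  then have "linked_path (Nd w ` X) (insert (inV w e) (inV w ` U)) (inV w e) (inV w e)"
    by (intro linked_linked_path.linked_path_start) (auto simp: inj_image_mem_iff[OF inj_inV] valid_edge_inV)
  then show ?case by simp
next
  case (linked_path_join X U e f X' U' e' f')
  have "feeds (inV w f) (inV w e')"
    using feeds_inV[OF linked_path_join.hyps(4)] linked_path_valid[OF linked_path_join.hyps(1)] linked_path_valid[OF linked_path_join.hyps(2)] by blast
  with linked_linked_path.linked_path_join[OF linked_path_join.IH] linked_path_join.hyps(3)
  have "linked_path (Nd w ` X \<union> Nd w ` X') (inV w ` U \<union> inV w ` U') (inV w e) (inV w f')" by blast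
  then show ?case by (simp add: image_Un)
next
  case (linked_close X U e f U')
  have "feeds (inV w f) (inV w e)" using feeds_inV[OF linked_close.hyps(2)] linked_path_valid[OF linked_close.hyps(1)] by blast
  then show ?case by (rule linked_linked_path.linked_close[OF linked_close.IH]) (use linked_close.hyps(3) in blast)
qed

text \<open>By \<open>feeds_inW\<close> the direction is reversed in the left block, so the two ends
  of a path exchange their roles.\<close>

lemma linked_path_inW:
  "linked X U \<Longrightarrow> linked ((\<lambda>w. Nd w v) ` X) (inW v ` U)"
  "linked_path X U e f \<Longrightarrow> linked_path ((\<lambda>w. Nd w v) ` X) (inW v ` U) (inW v f) (inW v e)"
proof (induction rule: linked_linked_path.inducts)
  case (linked_single t U)
  show ?case by (simp add: linked_linked_path.linked_single)
next
  case (linked_path_start X U e)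
  then have "linked_path ((\<lambda>w. Nd w v) ` X) (insert (inW v e) (inW v ` U)) (inW v e) (inW v e)"
    by (intro linked_linked_path.linked_path_start) (auto simp: inj_image_mem_iff[OF inj_inW] valid_edge_inW)
  then show ?case by simp
next
  case (linked_path_join X U e f X' U' e' f')
  have "feeds (inW v e') (inW v f)"
    using feeds_inW[OF linked_path_join.hyps(4)] linked_path_valid[OF linked_path_join.hyps(1)] linked_path_valid[OF linked_path_join.hyps(2)] by blast
  with linked_linked_path.linked_path_join[OF linked_path_join.IH(2,1)] linked_path_join.hyps(3)
  have "linked_path ((\<lambda>w. Nd w v) ` X' \<union> (\<lambda>w. Nd w v) ` X) (inW v ` U' \<union> inW v ` U) (inW v f') (inW v e)" by blast
  then show ?case by (simp add: image_Un Un_commute)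
next
  case (linked_close X U e f U')
  have "feeds (inW v e) (inW v f)" using feeds_inW[OF linked_close.hyps(2)] linked_path_valid[OF linked_close.hyps(1)] by blast
  then show ?case by (rule linked_linked_path.linked_close[OF linked_close.IH]) (use linked_close.hyps(3) in blast)
qed

text \<open>Gluing in two stages: each single cycle \<open>x\<close> is replaced by an already glued
  bunch \<open>Y x\<close>. The outer gluing still works because the edges it opens avoid
  \<open>W x\<close> and hence survive in the bunch.\<close>

lemma linked_path_subst:
  assumes Y: "\<And>x. x \<in> D \<Longrightarrow> linked (Y x) (W x) \<and> x \<in> Y x"
    and disj: "\<And>x x'. x \<in> D \<Longrightarrow> x' \<in> D \<Longrightarrow> x \<noteq> x' \<Longrightarrow> Y x \<inter> Y x' = {}"
  shows "linked X U \<Longrightarrow> X \<subseteq> D \<Longrightarrow> (\<And>x. x \<in> X \<Longrightarrow> U \<inter> W x = {}) \<Longrightarrow>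
      linked (\<Union> (Y ` X)) (U \<union> \<Union> (W ` X))"
    and "linked_path X U e f \<Longrightarrow> X \<subseteq> D \<Longrightarrow> (\<And>x. x \<in> X \<Longrightarrow> U \<inter> W x = {}) \<Longrightarrow>
      linked_path (\<Union> (Y ` X)) (U \<union> \<Union> (W ` X)) e f"
proof (induction rule: linked_linked_path.inducts)
  case (linked_single t U)
  then show ?case using Y[of t] by (auto intro: linked_mono)
next
  case (linked_path_start X U e)
  then have "linked_path (\<Union> (Y ` X)) (insert e (U \<union> \<Union> (W ` X))) e e"
    using Y by (intro linked_linked_path.linked_path_start) blast+
  then show ?case by simp
next
  case (linked_path_join X U e f X' U' e' f')
  have "\<Union> (Y ` X) \<inter> \<Union> (Y ` X') = {}" using disj linked_path_join by blast
  moreover have "linked_path (\<Union> (Y ` X)) (U \<union> \<Union> (W ` X)) e f" using linked_path_join by blast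
  moreover have "linked_path (\<Union> (Y ` X')) (U' \<union> \<Union> (W ` X')) e' f'" using linked_path_join by blast
  ultimately have "linked_path (\<Union> (Y ` X) \<union> \<Union> (Y ` X')) ((U \<union> \<Union> (W ` X)) \<union> (U' \<union> \<Union> (W ` X'))) e f'"
    using linked_path_join by (intro linked_linked_path.linked_path_join) auto
  then show ?case by (simp add: Un_ac)
next
  case (linked_close X U e f U')
  then have "linked_path (\<Union> (Y ` X)) (U \<union> \<Union> (W ` X)) e f" by blast
  then show ?case using linked_close by (auto intro: linked_linked_path.linked_close)
qed

definition nodes :: "dtree set \<Rightarrow> dtree set \<Rightarrow> dtree set" where
  "nodes X F = {Nd w v | w v. w \<in> X \<and> v \<in> F}"

text \<open>First the trees \<open>Nd w v\<close> with fixed \<open>v\<close> are glued inside their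
  left blocks; then each of them is replaced by its fibre over \<open>F\<close>, glued inside the
  right blocks. The two stages open edges in different blocks.\<close>

lemma linked_nodes:
  assumes X: "linked X U" and F: "linked F W" and v: "v \<in> F"
  shows "linked (nodes X F) (inW v ` (U \<inter> edges_of X) \<union> (\<Union>w\<in>X. inV w ` W))"
proof -
  let ?n = "\<lambda>w. Nd w v"
  let ?Y = "\<lambda>t. case t of Nd w _ \<Rightarrow> Nd w ` F" and ?W = "\<lambda>t. case t of Nd w _ \<Rightarrow> inV w ` W"
  have "linked (\<Union> (?Y ` (?n ` X))) (inW v ` (U \<inter> edges_of X) \<union> \<Union> (?W ` (?n ` X)))"
  proof (rule linked_path_subst(1))
    show "linked (?n ` X) (inW v ` (U \<inter> edges_of X))" by (intro linked_path_inW linked_path_edges_of X)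
    show "linked (?Y x) (?W x) \<and> x \<in> ?Y x" if "x \<in> ?n ` X" for x
      using that v F by (auto intro: linked_path_inV)
    show "?Y x \<inter> ?Y x' = {}" if "x \<in> ?n ` X" "x' \<in> ?n ` X" "x \<noteq> x'" for x x'
      using that by auto
    show "inW v ` (U \<inter> edges_of X) \<inter> ?W x = {}" if "x \<in> ?n ` X" for x
      using that by (auto simp: inW_def inV_def edges_of_def valid_edge_def)
  qed simp
  moreover have "\<Union> (?Y ` (?n ` X)) = nodes X F" by (auto simp: nodes_def)
  ultimately show ?thesis by simp
qed

section \<open>Linked sets as cycles of words\<close>

definition adjs :: "bool list set set" where
  "adjs = {{y, z} | y z. up y z \<or> z = map Not y}"

lemma edge_inj:
  assumes "{st t i, st t (Suc i)} = {st t' j, st t' (Suc j)}" "i < 2 * sz t" "j < 2 * sz t'"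
  shows "t = t' \<and> i = j"
  using assms st_inj[of t i t' j] st_inj[of t i t' "Suc j"] st_inj[of t "Suc i" t' j]
  by (auto simp: doubleton_eq_iff)

lemma lower_upper_edge: "{lower (t, j), upper (t, j)} = {st t j, st t (Suc j)}"
  by (auto simp: lower_def upper_def)

lemma set_states: "set (states t) = {st t j | j. j \<le> 2 * sz t}"
  by (auto simp: set_conv_nth st_def less_Suc_eq_le)

text \<open>\<open>good_cycle\<close> and \<open>good_path\<close> are the meaning of
  \<open>linked\<close> and \<open>linked_path\<close>. The last conjunct records the path edges
  that survive and are available for further gluing.\<close>

definition good_cycle :: "dtree set \<Rightarrow> tedge set \<Rightarrow> bool list list \<Rightarrow> bool" where
  "good_cycle X U l \<longleftrightarrow> l \<noteq> [] \<and> distinct l \<and> set l = (\<Union>t\<in>X. set (states t)) \<and> cedges l \<subseteq> adjs \<and>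
      (\<forall>t j. t \<in> X \<and> j < 2 * sz t \<and> (t, j) \<notin> U \<longrightarrow> {st t j, st t (Suc j)} \<in> cedges l)"

definition good_path :: "dtree set \<Rightarrow> tedge set \<Rightarrow> bool list list \<Rightarrow> bool" where
  "good_path X U l \<longleftrightarrow> l \<noteq> [] \<and> distinct l \<and> set l = (\<Union>t\<in>X. set (states t)) \<and> pedges l \<subseteq> adjs \<and>
      (\<forall>t j. t \<in> X \<and> j < 2 * sz t \<and> (t, j) \<notin> U \<longrightarrow> {st t j, st t (Suc j)} \<in> pedges l)"

lemma good_cycle_states: "good_cycle {t} U (states t)"
proof -
  have ne: "states t \<noteq> []" using length_states[of t] by (metis list.size(3) nat.distinct(1))
  have "distinct (states t)"
    unfolding distinct_conv_nth using st_inj[of t _ t] by (simp add: st_def less_Suc_eq_le) blast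
  moreover have "pedges (states t) \<subseteq> adjs"
  proof
    fix s assume "s \<in> pedges (states t)"
    then obtain j where j: "j < 2 * sz t" "s = {st t j, st t (Suc j)}"
      using pedges_conv_nth[of s "states t"] by (auto simp: st_def)
    then have "s = {lower (t, j), upper (t, j)}" by (simp add: lower_upper_edge)
    then show "s \<in> adjs" using up_lower_upper[OF j(1)] unfolding adjs_def by blast
  qed
  moreover have "{last (states t), hd (states t)} \<in> adjs"
  proof -
    have "hd (states t) = word t" using ne by (simp add: hd_conv_nth)
    moreover have "last (states t) = map Not (word t)"
      using ne st_last[of t] by (simp add: last_conv_nth st_def)
    ultimately have "{last (states t), hd (states t)} = {word t, map Not (word t)}" by auto
    then show ?thesis unfolding adjs_def by blast
  qed
  moreover have "{st t j, st t (Suc j)} \<in> pedges (states t)" if "j < 2 * sz t" for j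
    using pedges_nth[of j "states t"] that by (simp add: st_def)
  ultimately show ?thesis using ne by (simp add: good_cycle_def cedges_def)
qed

lemma good_cycle_open:
  assumes l: "good_cycle X U l" and e: "fst e \<in> X" "valid_edge e" "e \<notin> U"
  obtains l' where "good_path X (insert e U) l'" "hd l' = lower e" "last l' = upper e"
proof -
  obtain t j where tj: "e = (t, j)" by (cases e)
  with e have t: "t \<in> X" "j < 2 * sz t" "(t, j) \<notin> U" by (auto simp: valid_edge_def)
  then have "{st t j, st t (Suc j)} \<in> cedges l" using l unfolding good_cycle_def by blast
  then have "{lower e, upper e} \<in> cedges l" unfolding tj lower_upper_edge .
  moreover have "l \<noteq> []" using l unfolding good_cycle_def by blast
  ultimately obtain l' where l': "l' \<noteq> []" "set l' = set l" "distinct l' = distinct l" "cedges l' = cedges l"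
    "hd l' = lower e" "last l' = upper e" by (rule cedges_open)
  have "{st t' i, st t' (Suc i)} \<in> pedges l'" if "t' \<in> X" "i < 2 * sz t'" "(t', i) \<notin> insert e U" for t' i
  proof -
    have "{st t' i, st t' (Suc i)} \<in> cedges l'" using that l l'(4) unfolding good_cycle_def by blast
    \<comment> \<open>The path loses only the edge at \<open>e\<close>, and by
      \<open>edge_inj\<close> this is none of the other path edges.\<close>
    moreover have "{st t' i, st t' (Suc i)} \<noteq> {upper e, lower e}"
    proof
      assume "{st t' i, st t' (Suc i)} = {upper e, lower e}"
      also have "\<dots> = {st t j, st t (Suc j)}"
        unfolding lower_upper_edge[symmetric] tj by (rule insert_commute)
      finally have "t' = t \<and> i = j" using that t by (intro edge_inj)
      then show False using that tj by simp
    qed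
    ultimately show ?thesis unfolding cedges_def l'(5,6) by (elim insertE) simp_all
  qed
  moreover have "pedges l' \<subseteq> adjs"
  proof -
    have "pedges l' \<subseteq> cedges l'" by (simp add: cedges_def subset_insertI)
    also have "\<dots> \<subseteq> adjs" using l unfolding l'(4) good_cycle_def by (elim conjE)
    finally show ?thesis .
  qed
  ultimately have "good_path X (insert e U) l'"
    using l l'(1-3) unfolding good_path_def good_cycle_def by simp
  from that[OF this l'(5,6)] show thesis .
qed

lemma feeds_adjs: "feeds f e \<Longrightarrow> {upper f, lower e} \<in> adjs"
  unfolding feeds_def adjs_def by blast

lemma good_path_append:
  assumes l: "good_path X U l" and l': "good_path X' U' l'" and "X \<inter> X' = {}" "{last l, hd l'} \<in> adjs"
  shows "good_path (X \<union> X') (U \<union> U') (l @ l')"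
proof -
  have "set (states t) \<inter> set (states t') = {}" if "t \<in> X" "t' \<in> X'" for t t'
    using that assms(3) st_inj[of t _ t'] unfolding set_states by blast
  then have "set l \<inter> set l' = {}" using l l' unfolding good_path_def by blast
  moreover have "l \<noteq> []" "l' \<noteq> []" using l l' unfolding good_path_def by blast+
  moreover from this have p: "pedges (l @ l') = insert {last l, hd l'} (pedges l \<union> pedges l')"
    by (intro pedges_append)
  moreover have "pedges (l @ l') \<subseteq> adjs" using l l' assms(4) unfolding good_path_def p by blast
  moreover have "{st t j, st t (Suc j)} \<in> pedges (l @ l')"
    if "t \<in> X \<union> X'" "j < 2 * sz t" "(t, j) \<notin> U \<union> U'" for t j
    using that l l' unfolding good_path_def p by blast
  ultimately show ?thesis using l l' unfolding good_path_def by simp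
qed

lemma linked_cycle:
  "linked X U \<Longrightarrow> \<exists>l. good_cycle X U l"
  "linked_path X U e f \<Longrightarrow> \<exists>l. good_path X U l \<and> hd l = lower e \<and> last l = upper f"
proof (induction rule: linked_linked_path.inducts)
  case (linked_single t U)
  show ?case using good_cycle_states by blast
next
  case (linked_path_start X U e)
  then obtain l where "good_cycle X U l" by blast
  from good_cycle_open[OF this linked_path_start.hyps(2,3,4)] show ?case by blast
next
  case (linked_path_join X U e f X' U' e' f')
  then obtain l l' where l: "good_path X U l" "hd l = lower e" "last l = upper f"
    and l': "good_path X' U' l'" "hd l' = lower e'" "last l' = upper f'" by blast
  then have "good_path (X \<union> X') (U \<union> U') (l @ l')"
    using linked_path_join.hyps(3) feeds_adjs[OF linked_path_join.hyps(4)] by (intro good_path_append) simp_all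
  moreover have "l \<noteq> []" "l' \<noteq> []" using l(1) l'(1) unfolding good_path_def by blast+
  ultimately show ?case using l l' by (intro exI[of _ "l @ l'"]) simp
next
  case (linked_close X U e f U')
  then obtain l where l: "good_path X U l" "hd l = lower e" "last l = upper f" by blast
  then have "good_cycle X U' l"
    using feeds_adjs[OF linked_close.hyps(2)] linked_close.hyps(3) unfolding good_path_def good_cycle_def cedges_def by simp blast
  then show ?case by blast
qed

section \<open>From words to the odd graph\<close>

definition trees :: "nat \<Rightarrow> dtree set" where
  "trees m = {t. sz t = m}"

section \<open>Closed walks from cyclic lists\<close>

lemma vwalk_arcs_walk:
  "l \<noteq> [] \<Longrightarrow> pcas (hd l) (vwalk_arcs l) (last l) \<and> pawalk_verts (hd l) (vwalk_arcs l) = l"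
  by (induction l rule: vwalk_arcs.induct) auto

lemma vwalk_arcs_pedges: "(a, b) \<in> set (vwalk_arcs l) \<Longrightarrow> {a, b} \<in> pedges l"
  by (induction l rule: vwalk_arcs.induct) auto

lemma pedges_subset: "s \<in> pedges l \<Longrightarrow> s \<subseteq> set l"
  by (induction l rule: pedges.induct) auto

lemma fst_vwalk_arcs: "fst ` set (vwalk_arcs (l @ [x])) = set l"
proof (induction l)
  case (Cons y l)
  then show ?case by (cases l) auto
qed simp

lemma cedges_eq: "l \<noteq> [] \<Longrightarrow> pedges (l @ [hd l]) = cedges l"
  by (simp add: pedges_append cedges_def)

lemma hamilton_cycleI:
  assumes l: "distinct l" "3 \<le> length l" "set l = pverts G"
    and adj: "\<And>a b. a \<in> pverts G \<Longrightarrow> b \<in> pverts G \<Longrightarrow> {a, b} \<in> cedges l \<Longrightarrow> (a, b) \<in> parcs G"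
  shows "\<exists>p. pre_digraph.hamilton_cycle (with_proj G) p"
proof -
  \<comment> \<open>Repeating the first vertex closes the walk; the tails of its arcs are then
    exactly the entries of \<open>l\<close>.\<close>
  let ?L = "l @ [hd l]"
  let ?p = "vwalk_arcs ?L"
  have ne: "l \<noteq> []" using l(2) by auto
  have hd: "hd ?L = hd l" "last ?L = hd l" using ne by simp_all
  have walk: "pcas (hd l) ?p (hd l)" "pawalk_verts (hd l) ?p = ?L"
    using vwalk_arcs_walk[of ?L] unfolding hd by blast+
  have verts: "a \<in> pverts G \<and> b \<in> pverts G" if "(a, b) \<in> set ?p" for a b
  proof -
    have "set ?L = set l" using ne by (simp add: insert_absorb)
    with pedges_subset[OF vwalk_arcs_pedges[OF that]] have "{a, b} \<subseteq> set l" by blast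
    then show ?thesis unfolding l(3) by blast
  qed
  have "set ?p \<subseteq> parcs G"
  proof
    fix e assume "e \<in> set ?p"
    moreover obtain a b where e1: "e = (a, b)" by (cases e)
    ultimately have e: "e = (a, b)" "(a, b) \<in> set ?p" by simp_all
    from vwalk_arcs_pedges[OF e(2)] have "{a, b} \<in> cedges l" unfolding cedges_eq[OF ne] .
    with verts[OF e(2)] adj e(1) show "e \<in> parcs G" by blast
  qed
  moreover have "distinct (tl ?L)" using l(1) ne by (cases l) auto
  moreover have "hd l \<in> pverts G" using hd_in_set[OF ne] unfolding l(3) .
  ultimately have "pre_digraph.awalk (with_proj G) (hd l) ?p (hd l)"
    "distinct (tl (pre_digraph.awalk_verts (with_proj G) (hd l) ?p))"
    unfolding pre_digraph.awalk_def with_proj_simps cas_with_proj_eq awalk_verts_with_proj_eq walk(2)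
    using walk(1) by blast+
  moreover have len: "3 \<le> length ?p"
    using l(2) vwalk_length_simp[of ?L] unfolding vwalk_length_def by simp
  moreover have "?p \<noteq> []" using len by (intro notI) simp
  moreover have "tail (with_proj G) ` set ?p = verts (with_proj G)"
    unfolding with_proj_simps fst_vwalk_arcs by (rule l(3))
  ultimately show ?thesis
    unfolding pre_digraph.hamilton_cycle_def pre_digraph.cycle_def by blast
qed

section \<open>Words as vertices of the odd graph\<close>

definition ones :: "bool list \<Rightarrow> nat set" where
  "ones y = Suc ` {i. i < length y \<and> y ! i}"

text \<open>A word of length \<open>2 * k\<close> and height 2 has \<open>k + 1\<close> ones, so its
  complement in the larger ground set has \<open>k\<close> elements, among them
  \<open>2 * k + 1\<close>.\<close>

definition vtx :: "nat \<Rightarrow> bool list \<Rightarrow> nat set" where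
  "vtx k y = (if ht y = 0 then ones y else {1..2 * k + 1} - ones y)"

lemma card_ones: "2 * int (card (ones y)) = int (length y) + ht y"
proof -
  have "card (ones y) = length (filter id y)"
    unfolding ones_def by (subst card_image) (simp_all add: length_filter_conv_card)
  moreover have "2 * int (length (filter id y)) = int (length y) + ht y"
    by (induction y) auto
  ultimately show ?thesis by simp
qed

lemma ones_subset: "ones y \<subseteq> {1..length y}"
  by (auto simp: ones_def)

lemma ones_inj: "length y = length z \<Longrightarrow> ones y = ones z \<Longrightarrow> y = z"
proof (rule nth_equalityI)
  fix i assume a: "length y = length z" "ones y = ones z" "i < length y"
  have "Suc i \<in> ones y \<longleftrightarrow> y ! i" "Suc i \<in> ones z \<longleftrightarrow> z ! i"
    using a by (auto simp: ones_def)
  then show "y ! i = z ! i" using a(2) by simp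
qed

lemma ones_up: "up y z \<Longrightarrow> ones y \<subseteq> ones z"
  by (auto simp: up_def ones_def nth_append nth_Cons split: nat.splits if_splits)

definition mid :: "nat \<Rightarrow> bool list set" where
  "mid k = {y. length y = 2 * k \<and> (ht y = 0 \<or> ht y = 2)}"

lemma states_mid: "(\<Union>t\<in>trees k. set (states t)) = mid k"
proof
  show "(\<Union>t\<in>trees k. set (states t)) \<subseteq> mid k"
    by (auto simp: trees_def set_states mid_def ht_st length_st split: if_splits)
  show "mid k \<subseteq> (\<Union>t\<in>trees k. set (states t))"
  proof
    fix y assume y: "y \<in> mid k"
    then obtain t j where tj: "j \<le> 2 * sz t" "st t j = y" using st_surj[of y] by (auto simp: mid_def)
    then have "sz t = k" using length_st[of j t] y by (auto simp: mid_def)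
    then show "y \<in> (\<Union>t\<in>trees k. set (states t))" using tj by (auto simp: trees_def set_states)
  qed
qed

text \<open>Membership of \<open>2 * k + 1\<close> tells which of the two levels the word came from,
  and then the complement can be undone.\<close>

lemma vtx_inj: "inj_on (vtx k) (mid k)"
proof (rule inj_onI)
  fix y z assume y: "y \<in> mid k" and z: "z \<in> mid k" and eq: "vtx k y = vtx k z"
  have sub: "ones u \<subseteq> {1..2 * k}" "2 * k + 1 \<notin> ones u" if "u \<in> mid k" for u
    using ones_subset[of u] that by (auto simp: mid_def)
  have "2 * k + 1 \<in> vtx k u \<longleftrightarrow> ht u \<noteq> 0" if "u \<in> mid k" for u
    using sub[OF that] by (auto simp: vtx_def)
  then have "ht y = 0 \<longleftrightarrow> ht z = 0" using y z eq by metis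
  moreover have "ones y = {1..2 * k + 1} - ({1..2 * k + 1} - ones y)" if "y \<in> mid k" for y
    using sub(1)[OF that] by auto
  ultimately have "ones y = ones z" using eq y z by (metis vtx_def)
  then show "y = z" using ones_inj y z by (simp add: mid_def)
qed

lemma vtx_image: "vtx k ` mid k = {A. A \<subseteq> {1..2 * k + 1} \<and> card A = k}" (is "_ = ?V")
proof
  show "vtx k ` mid k \<subseteq> ?V"
  proof
    fix A assume "A \<in> vtx k ` mid k"
    then obtain y where y: "y \<in> mid k" "A = vtx k y" by blast
    have s: "ones y \<subseteq> {1..2 * k + 1}" using ones_subset[of y] y by (auto simp: mid_def)
    have c: "2 * int (card (ones y)) = 2 * int k + ht y" using card_ones[of y] y by (simp add: mid_def)
    show "A \<in> ?V"
    proof (cases "ht y = 0")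
      case True
      then show ?thesis using y s c by (simp add: vtx_def)
    next
      case False
      then have "card (ones y) = k + 1" using c y by (auto simp: mid_def)
      then have "card ({1..2 * k + 1} - ones y) = k" using s by (subst card_Diff_subset) (auto simp: ones_def)
      then show ?thesis using y False by (simp add: vtx_def)
    qed
  qed
  show "?V \<subseteq> vtx k ` mid k"
  proof
    fix A assume A: "A \<in> ?V"
    \<comment> \<open>\<open>?y B\<close> is the characteristic word of \<open>B\<close>.\<close>
    let ?y = "\<lambda>B. map (\<lambda>i. Suc i \<in> B) [0..<2 * k]"
    have ones: "ones (?y B) = B" if "B \<subseteq> {1..2 * k}" for B
    proof
      show "B \<subseteq> ones (?y B)"
      proof
        fix b assume "b \<in> B"
        then have "b \<in> {1..2 * k}" "b \<in> B" using that by auto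
        then show "b \<in> ones (?y B)" by (cases b) (auto simp: ones_def)
      qed
    qed (auto simp: ones_def)
    have ht: "ht (?y B) = 2 * int (card B) - 2 * int k" if "B \<subseteq> {1..2 * k}" for B
      using card_ones[of "?y B"] ones[OF that] by simp
    show "A \<in> vtx k ` mid k"
    proof (cases "2 * k + 1 \<in> A")
      case False
      then have s: "A \<subseteq> {1..2 * k}" using A by (auto simp: subset_iff le_Suc_eq)
      then have "?y A \<in> mid k" "vtx k (?y A) = A" using ht[OF s] ones[OF s] A by (simp_all add: mid_def vtx_def)
      then show ?thesis by (metis imageI)
    next
      case True
      \<comment> \<open>A vertex containing \<open>2 * k + 1\<close> comes from the
        \<open>k + 1\<close> elements of \<open>{1..2 * k}\<close> that it misses.\<close>
      let ?B = "{1..2 * k} - A"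
      have fin: "finite A" using A finite_subset by blast
      have "card (A - {2 * k + 1}) = k - 1" using True A fin by simp
      moreover have "A - {2 * k + 1} \<subseteq> {1..2 * k}" using A by (auto simp: subset_iff le_Suc_eq)
      moreover have B: "?B = {1..2 * k} - (A - {2 * k + 1})" by auto
      moreover have "card A > 0" using True fin card_gt_0_iff by blast
      then have "k > 0" using A by simp
      ultimately have c: "card ?B = k + 1" using fin by (simp add: card_Diff_subset)
      have s: "?B \<subseteq> {1..2 * k}" by blast
      have "{1..2 * k + 1} - ?B = A" using True A by (auto simp: le_Suc_eq)
      then have "vtx k (?y ?B) = A" using ht[OF s] ones[OF s] c by (simp add: vtx_def)
      moreover have "?y ?B \<in> mid k" using ht[OF s] c by (simp add: mid_def)
      ultimately show ?thesis by (metis imageI)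
    qed
  qed
qed

text \<open>Along an upward flip the lower set lies inside the set whose complement is the other
  vertex. Complementary words in \<open>mid k\<close> both have height 0 and have disjoint sets of
  ones.\<close>

lemma vtx_disjoint:
  assumes "{y, z} \<in> adjs" "y \<in> mid k" "z \<in> mid k"
  shows "vtx k y \<inter> vtx k z = {}"
proof -
  have U: "vtx k y \<inter> vtx k z = {}" if "up y z" "y \<in> mid k" "z \<in> mid k" for y z
  proof -
    have "ht z = ht y + 2" using that(1) by (auto simp: up_def)
    then have "ht y = 0" "ht z \<noteq> 0" using that by (auto simp: mid_def)
    then show ?thesis using ones_up[OF that(1)] by (auto simp: vtx_def)
  qed
  have N: "vtx k y \<inter> vtx k z = {}" if "z = map Not y" "y \<in> mid k" "z \<in> mid k" for y z
  proof -
    have "ht y = 0" "ht z = 0" using that by (auto simp: mid_def)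
    then show ?thesis using that by (auto simp: vtx_def ones_def)
  qed
  from assms(1) consider "up y z" | "up z y" | "z = map Not y" | "y = map Not z"
    by (auto simp: adjs_def doubleton_eq_iff)
  then show ?thesis using U[of y z] U[of z y] N[of y z] N[of z y] assms(2,3) by cases blast+
qed

lemma pedges_map: "pedges (map f l) = (`) f ` pedges l"
  by (induction l rule: pedges.induct) auto

lemma hamilton_cycle_of_linked:
  assumes "linked (trees k) U" "k \<ge> 1"
  shows "\<exists>p. pre_digraph.hamilton_cycle (with_proj (odd_graph k)) p"
proof -
  from linked_cycle(1)[OF assms(1)] obtain l where "good_cycle (trees k) U l" by blast
  then have l: "l \<noteq> []" "distinct l" "set l = mid k" "cedges l \<subseteq> adjs"
    unfolding good_cycle_def states_mid by blast+
  let ?L = "map (vtx k) l"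
  have V: "pverts (odd_graph k) = {A. A \<subseteq> {1..2 * k + 1} \<and> card A = k}"
    by (simp add: odd_graph_def kneser_graph_def)
  have d: "distinct ?L" using l vtx_inj by (simp add: distinct_map)
  have s: "set ?L = pverts (odd_graph k)" using l(3) vtx_image[of k] V by simp
  have cm: "cedges ?L = (`) (vtx k) ` cedges l"
    using l(1) by (simp add: cedges_def pedges_map hd_map last_map)
  have sub: "s \<subseteq> mid k" if "s \<in> cedges l" for s
  proof -
    have "s \<subseteq> set l" using that l(1) pedges_subset[of s l] by (auto simp: cedges_def)
    then show ?thesis using l(3) by simp
  qed
  have adj: "(a, b) \<in> parcs (odd_graph k)"
    if ab: "a \<in> pverts (odd_graph k)" "b \<in> pverts (odd_graph k)" "{a, b} \<in> cedges ?L" for a b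
  proof -
    obtain s where s: "s \<in> cedges l" "{a, b} = vtx k ` s" using ab(3) unfolding cm by (rule imageE)
    then have "s \<in> adjs" using l(4) by blast
    then obtain y z where yz: "s = {y, z}" by (auto simp: adjs_def)
    then have "vtx k y \<inter> vtx k z = {}" using vtx_disjoint[of y z k] \<open>s \<in> adjs\<close> sub[OF s(1)] by simp
    moreover have "a = vtx k y \<and> b = vtx k z \<or> a = vtx k z \<and> b = vtx k y"
      using s yz by (auto simp: doubleton_eq_iff)
    ultimately have "a \<inter> b = {}" by auto
    then show ?thesis using ab(1,2) V by (simp add: odd_graph_def kneser_graph_def)
  qed
  have "3 \<le> length ?L"
  proof -
    obtain t where t: "t \<in> trees k" using l(1,3) states_mid[of k] by (cases l) auto
    then have "set (states t) \<subseteq> set l" using states_mid[of k] l(3) by blast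
    then have "card (set (states t)) \<le> card (set l)" by (intro card_mono) simp_all
    moreover have "card (set (states t)) = 2 * k + 1"
      using good_cycle_states[of t U] t by (simp add: good_cycle_def distinct_card trees_def)
    ultimately show ?thesis using card_length[of l] assms(2) by simp
  qed
  then show ?thesis using hamilton_cycleI[OF d _ s adj] by blast
qed

section \<open>Gluing all cycles\<close>

text \<open>\<open>chain n\<close> encodes the zigzag word, \<open>n\<close> copies of
  \<open>True, False\<close>, which \<open>rc\<close> fixes. Chains and hooks occur as left subtrees
  in the 6-cycles that connect the classes of trees with equal left size.\<close>

fun chain :: "nat \<Rightarrow> dtree" where
  "chain 0 = Lf"
| "chain (Suc n) = Nd Lf (chain n)"

definition hook :: "nat \<Rightarrow> dtree" where
  "hook m = Nd (Nd Lf Lf) (chain (m - 2))"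

lemma chain_2: "chain 2 = Nd Lf (Nd Lf Lf)"
  by (simp add: numeral_2_eq_2)

lemma sz_chain [simp]: "sz (chain n) = n"
  by (induction n) auto

lemma sz_hook: "2 \<le> m \<Longrightarrow> sz (hook m) = m"
  by (simp add: hook_def)

lemma chain_inj [simp]: "chain m = chain n \<longleftrightarrow> m = n"
  by (metis sz_chain)

lemma word_chain_snoc: "word (chain n) @ [True, False] = True # False # word (chain n)"
  by (induction n) auto

lemma rc_word_chain [simp]: "rc (word (chain n)) = word (chain n)"
  by (induction n) (auto simp: word_chain_snoc)

lemma trees_0: "trees 0 = {Lf}"
proof -
  have "sz t = 0 \<longleftrightarrow> t = Lf" for t by (cases t) auto
  then show ?thesis by (auto simp: trees_def)
qed

lemma trees_Suc: "trees (Suc n) = (\<Union>a\<in>{..n}. nodes (trees a) (trees (n - a)))"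
proof -
  have "t \<in> trees (Suc n) \<longleftrightarrow> t \<in> (\<Union>a\<in>{..n}. nodes (trees a) (trees (n - a)))" for t
    by (cases t) (auto simp: trees_def nodes_def)
  then show ?thesis by blast
qed

lemma nodes_simps [simp]:
  "nodes {} F = {}" "nodes (insert w X) F = Nd w ` F \<union> nodes X F"
  by (auto simp: nodes_def)

lemma trees_1: "trees (Suc 0) = {Nd Lf Lf}"
  by (simp add: trees_Suc trees_0)

lemma trees_2: "trees 2 = {chain 2, hook 2}"
  by (simp add: trees_Suc trees_0 trees_1 numeral_2_eq_2 atMost_Suc hook_def insert_commute)

lemma nodes_disjoint: "a \<noteq> b \<Longrightarrow> nodes (trees a) F \<inter> nodes (trees b) F' = {}"
  by (auto simp: nodes_def trees_def)

text \<open>An alternating 6-cycle: three components are opened at one edge each, and the resulting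
  paths are joined in cyclic order.\<close>

lemma linked_glue3:
  assumes "linked X1 U1" "linked X2 U2" "linked X3 U3"
    and "X1 \<inter> X2 = {}" "X1 \<inter> X3 = {}" "X2 \<inter> X3 = {}"
    and "fst e1 \<in> X1" "fst e2 \<in> X2" "fst e3 \<in> X3" "valid_edge e1" "valid_edge e2" "valid_edge e3"
    and "e1 \<notin> U1" "e2 \<notin> U2" "e3 \<notin> U3"
    and "feeds e1 e2" "feeds e2 e3" "feeds e3 e1"
  shows "linked (X1 \<union> X2 \<union> X3) (insert e1 U1 \<union> insert e2 U2 \<union> insert e3 U3)"
proof (rule linked_close)
  show "linked_path (X1 \<union> X2 \<union> X3) (insert e1 U1 \<union> insert e2 U2 \<union> insert e3 U3) e1 e3"
    by (rule linked_path_join[OF linked_path_join[OF linked_path_start linked_path_start] linked_path_start]) (use assms in \<open>simp_all add: Int_Un_distrib2\<close>)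
qed (use assms in simp_all)

lemma linked_glue4:
  assumes "linked X1 U1" "linked X2 U2" "linked X3 U3" "linked X4 U4"
    and "X1 \<inter> X2 = {}" "X1 \<inter> X3 = {}" "X2 \<inter> X3 = {}" "X1 \<inter> X4 = {}" "X2 \<inter> X4 = {}" "X3 \<inter> X4 = {}"
    and "fst e1 \<in> X1" "fst e2 \<in> X2" "fst e3 \<in> X3" "fst e4 \<in> X4" "valid_edge e1" "valid_edge e2" "valid_edge e3" "valid_edge e4"
    and "e1 \<notin> U1" "e2 \<notin> U2" "e3 \<notin> U3" "e4 \<notin> U4"
    and "feeds e1 e2" "feeds e2 e3" "feeds e3 e4" "feeds e4 e1"
  shows "linked (X1 \<union> X2 \<union> X3 \<union> X4) (insert e1 U1 \<union> insert e2 U2 \<union> insert e3 U3 \<union> insert e4 U4)"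
proof (rule linked_close)
  show "linked_path (X1 \<union> X2 \<union> X3 \<union> X4) (insert e1 U1 \<union> insert e2 U2 \<union> insert e3 U3 \<union> insert e4 U4) e1 e4"
    by (rule linked_path_join[OF linked_path_join[OF linked_path_join[OF linked_path_start linked_path_start] linked_path_start] linked_path_start])
      (use assms in \<open>simp_all add: Int_Un_distrib2\<close>)
qed (use assms in simp_all)

text \<open>This 6-cycle ties a chain fibre and a hook fibre of one class to the class of the next
  smaller left size. \<open>e2\<close> is the first seam; \<open>e1\<close> and \<open>e3\<close>
  are left-block copies of edge 3 of the hook and edge 0 of the smaller chain.\<close>

lemma feeds_class:
  fixes v :: dtree and n :: nat
  defines "e1 \<equiv> (Nd (hook (Suc (Suc n))) v, 4)" and "e2 \<equiv> (Nd (chain (Suc (Suc n))) v, 0)"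
    and "e3 \<equiv> (Nd (chain (Suc n)) (Nd Lf v), 1)"
  shows "feeds e1 e3" "feeds e3 e2" "feeds e2 e1"
  unfolding e1_def e2_def e3_def
  by (simp_all add: feeds_def lower_def upper_def st_def hook_def nth_append)

text \<open>A variant for left size 2 whose third tree has left size 0 instead of 1.\<close>

lemma feeds_class2:
  fixes v :: dtree
  defines "e1 \<equiv> (Nd (hook 2) v, 3)" and "e2 \<equiv> (Nd (chain 2) v, 0)"
    and "e3 \<equiv> (Nd Lf (Nd (Nd Lf Lf) v), 0)"
  shows "feeds e1 e3" "feeds e3 e2" "feeds e2 e1"
  unfolding e1_def e2_def e3_def
  by (simp_all add: feeds_def lower_def upper_def st_def hook_def chain_2)

text \<open>This joins left sizes 1, 2 and 3. \<open>e1\<close> is a left-block edge,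
  \<open>e2\<close> the seam between the two blocks, and \<open>e3\<close> the copy of edge 2 of the
  right subtree.\<close>

lemma feeds_class1_class3:
  fixes v :: dtree
  defines "e1 \<equiv> (Nd (hook 2) (Nd Lf v), 2)" and "e2 \<equiv> (Nd (hook 3) v, 7)"
    and "e3 \<equiv> (Nd (Nd Lf Lf) (Nd Lf (Nd Lf v)), 6)"
  shows "feeds e1 e3" "feeds e3 e2" "feeds e2 e1"
  unfolding e1_def e2_def e3_def
  by (simp_all add: feeds_def lower_def upper_def st_def hook_def nth_append)

text \<open>A bound, by positions, for the edges opened in \<open>linked_nodes\<close>. The seams at
  positions \<open>0\<close> and \<open>2 * sz w + 1\<close> never belong to it, so they remain
  available for gluing classes.\<close>

definition nodes_used :: "dtree set \<Rightarrow> dtree set \<Rightarrow> dtree \<Rightarrow> tedge set \<Rightarrow> tedge set \<Rightarrow> tedge set" where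
  "nodes_used X F v U W = {(Nd w v', j) | w v' j. w \<in> X \<and> v' \<in> F \<and>
      (v' = v \<and> 1 \<le> j \<and> j \<le> 2 * sz w \<and> (w, j - 1) \<in> U \<or>
       2 * sz w + 2 \<le> j \<and> (v', j - (2 * sz w + 2)) \<in> W)}"

lemma nodes_used_iff [simp]: "(Nd w v', j) \<in> nodes_used X F v U W \<longleftrightarrow> w \<in> X \<and> v' \<in> F \<and>
      (v' = v \<and> 1 \<le> j \<and> j \<le> 2 * sz w \<and> (w, j - 1) \<in> U \<or>
       2 * sz w + 2 \<le> j \<and> (v', j - (2 * sz w + 2)) \<in> W)"
  by (auto simp: nodes_used_def)

lemma fst_nodes_used: "e \<in> nodes_used X F v U W \<Longrightarrow> fst e \<in> nodes X F"
  by (auto simp: nodes_used_def nodes_def)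

lemma linked_nodes_used:
  assumes "linked X U" "linked F W" "v \<in> F"
  shows "linked (nodes X F) (nodes_used X F v U W)"
proof (rule linked_mono)
  show "linked (nodes X F) (inW v ` (U \<inter> edges_of X) \<union> (\<Union>w\<in>X. inV w ` (W \<inter> edges_of F)))"
    by (rule linked_nodes[OF assms(1) linked_path_edges_of(1)[OF assms(2)] assms(3)])
  show "inW v ` (U \<inter> edges_of X) \<union> (\<Union>w\<in>X. inV w ` (W \<inter> edges_of F)) \<subseteq> nodes_used X F v U W"
    using assms(3) by (auto simp: inW_def inV_def edges_of_def valid_edge_def)
qed

text \<open>The edges that must not be used are the ones needed for gluing classes at later stages.\<close>
definition linkable :: "nat \<Rightarrow> bool" where
  "linkable m \<longleftrightarrow> (\<exists>U. linked (trees m) U \<and> (chain m, 0) \<notin> U \<and> (chain m, 2) \<notin> U)"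

text \<open>A 6-cycle absorbs two components at a time. \<open>chain m\<close> and
  \<open>hook m\<close> must lie in different ones because \<open>feeds_class\<close> opens one edge
  in the fibre of each.\<close>

definition bilinkable :: "nat \<Rightarrow> bool" where
  "bilinkable m \<longleftrightarrow> (\<exists>X Y U. X \<union> Y = trees m \<and> X \<inter> Y = {} \<and> linked X U \<and> linked Y U \<and>
     chain m \<in> X \<and> hook m \<in> Y \<and> (chain m, 0) \<notin> U \<and> (hook m, 3) \<notin> U)"

lemma bilinkable_2: "bilinkable 2"
  unfolding bilinkable_def
  by (rule exI[of _ "{chain 2}"], rule exI[of _ "{hook 2}"], rule exI[of _ "{}"])
    (auto simp: trees_2 linked_single hook_def chain_2)

lemma linked_attach:
  assumes M: "linked M U" and XY: "linked X V" "linked Y V" "X \<inter> Y = {}" and F: "linked F W" "v \<in> F"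
    and disj: "M \<inter> nodes (X \<union> Y) F = {}"
    and x: "x \<in> X" and y: "y \<in> Y" "i < 2 * sz y" "(y, i) \<notin> V"
    and e: "fst e \<in> M" "valid_edge e" "e \<notin> U"
    and feeds: "feeds (Nd y v, Suc i) e" "feeds e (Nd x v, 0)" "feeds (Nd x v, 0) (Nd y v, Suc i)"
  shows "linked (M \<union> nodes (X \<union> Y) F) (U \<union> {e, (Nd y v, Suc i), (Nd x v, 0)} \<union> nodes_used (X \<union> Y) F v V W)"
proof (rule linked_mono)
  have un: "nodes (X \<union> Y) F = nodes X F \<union> nodes Y F" by (auto simp: nodes_def)
  let ?UX = "nodes_used X F v V W" and ?UY = "nodes_used Y F v V W"
  let ?U = "insert e U \<union> insert (Nd x v, 0) ?UX \<union> insert (Nd y v, Suc i) ?UY"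
  have "linked (M \<union> nodes X F \<union> nodes Y F) ?U"
  proof (rule linked_glue3[OF M linked_nodes_used[OF XY(1) F] linked_nodes_used[OF XY(2) F]])
    show "M \<inter> nodes X F = {}" "M \<inter> nodes Y F = {}" using disj un by auto
    show "nodes X F \<inter> nodes Y F = {}" using XY(3) by (auto simp: nodes_def)
    show "fst e \<in> M" "valid_edge e" "e \<notin> U" by fact+
    show "fst (Nd x v, 0) \<in> nodes X F" "fst (Nd y v, Suc i) \<in> nodes Y F"
      using x y F(2) by (auto simp: nodes_def)
    show "valid_edge (Nd x v, 0)" "valid_edge (Nd y v, Suc i)" using y(2) by (auto simp: valid_edge_def)
    show "(Nd x v, 0) \<notin> ?UX" "(Nd y v, Suc i) \<notin> ?UY" using y by auto
  qed (use feeds in simp_all)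
  then show "linked (M \<union> nodes (X \<union> Y) F) ?U" by (simp add: un Un_assoc)
  show "?U \<subseteq> U \<union> {e, (Nd y v, Suc i), (Nd x v, 0)} \<union> nodes_used (X \<union> Y) F v V W"
    by (auto simp: nodes_used_def)
qed

lemma linked_leaf3:
  assumes "linked M U" "t1 \<in> M" "t2 \<notin> M" "t3 \<notin> M" "t2 \<noteq> t3"
    "valid_edge (t1, j1)" "valid_edge (t2, j2)" "valid_edge (t3, j3)" "(t1, j1) \<notin> U"
    "feeds (t1, j1) (t2, j2)" "feeds (t2, j2) (t3, j3)" "feeds (t3, j3) (t1, j1)"
  shows "linked (insert t2 (insert t3 M)) (insert (t1, j1) (insert (t2, j2) (insert (t3, j3) U)))"
proof -
  have "linked (M \<union> {t2} \<union> {t3}) (insert (t1, j1) U \<union> insert (t2, j2) {} \<union> insert (t3, j3) {})"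
    by (rule linked_glue3[OF assms(1) linked_single linked_single]) (use assms in auto)
  moreover have "M \<union> {t2} \<union> {t3} = insert t2 (insert t3 M)"
    "insert (t1, j1) U \<union> insert (t2, j2) {} \<union> insert (t3, j3) {} =
      insert (t1, j1) (insert (t2, j2) (insert (t3, j3) U))" by auto
  ultimately show ?thesis by simp
qed

lemma linked_leaf4:
  assumes "linked M U" "t1 \<in> M" "t2 \<notin> M" "t3 \<notin> M" "t4 \<notin> M" "t2 \<noteq> t3" "t2 \<noteq> t4" "t3 \<noteq> t4"
    "valid_edge (t1, j1)" "valid_edge (t2, j2)" "valid_edge (t3, j3)" "valid_edge (t4, j4)" "(t1, j1) \<notin> U"
    "feeds (t1, j1) (t2, j2)" "feeds (t2, j2) (t3, j3)" "feeds (t3, j3) (t4, j4)" "feeds (t4, j4) (t1, j1)"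
  shows "linked (insert t2 (insert t3 (insert t4 M)))
    (insert (t1, j1) (insert (t2, j2) (insert (t3, j3) (insert (t4, j4) U))))"
proof -
  have "linked (M \<union> {t2} \<union> {t3} \<union> {t4})
      (insert (t1, j1) U \<union> insert (t2, j2) {} \<union> insert (t3, j3) {} \<union> insert (t4, j4) {})"
    by (rule linked_glue4[OF assms(1) linked_single linked_single linked_single]) (use assms in auto)
  moreover have "M \<union> {t2} \<union> {t3} \<union> {t4} = insert t2 (insert t3 (insert t4 M))"
    "insert (t1, j1) U \<union> insert (t2, j2) {} \<union> insert (t3, j3) {} \<union> insert (t4, j4) {} =
      insert (t1, j1) (insert (t2, j2) (insert (t3, j3) (insert (t4, j4) U)))" by auto
  ultimately show ?thesis by simp
qed

section \<open>Explicit gluings for sizes 3 and 4\<close>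

lemmas edge_simps = valid_edge_def feeds_def lower_def upper_def st_def

lemma chain_3: "chain 3 = Nd Lf (Nd Lf (Nd Lf Lf))"
  by (simp add: numeral_3_eq_3)

lemma chain_4: "chain 4 = Nd Lf (Nd Lf (Nd Lf (Nd Lf Lf)))"
  by (simp add: eval_nat_numeral)

lemma trees_3: "trees 3 = nodes (trees 0) (trees 2) \<union> nodes (trees 1) (trees 1) \<union> nodes (trees 2) (trees 0)"
  using trees_Suc[of 2] by (simp add: numeral_2_eq_2 numeral_3_eq_3 atMost_Suc Un_ac)

lemma trees_4: "trees 4 = nodes (trees 0) (trees 3) \<union> nodes (trees 1) (trees 2) \<union> nodes (trees 2) (trees 1) \<union>
    nodes (trees 3) (trees 0)"
  using trees_Suc[of 3] by (simp add: eval_nat_numeral atMost_Suc Un_ac)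

lemmas trees_simps = trees_0 trees_1 trees_2 trees_3 trees_4 hook_def chain_2

text \<open>The gluings for sizes 3 and 4 were found by a computer search.\<close>
lemma linkable_3: "linkable 3"
proof -
  let ?t0 = "Nd Lf (Nd Lf (Nd Lf Lf))"
  let ?t1 = "Nd (Nd (Nd Lf Lf) Lf) Lf"
  let ?t2 = "Nd (Nd Lf Lf) (Nd Lf Lf)"
  let ?t3 = "Nd Lf (Nd (Nd Lf Lf) Lf)"
  let ?t4 = "Nd (Nd Lf (Nd Lf Lf)) Lf"
  \<comment> \<open>Two 6-cycles reduce five components to one; \<open>chain 3\<close>, which is
    \<open>?t0\<close>, is opened only at position 4.\<close>
  have c0: "linked {?t0} {}" by (rule linked_single)
  let ?M1 = "insert ?t1 (insert ?t2 {?t0})"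
  let ?U1 = "insert (?t0, 4::nat) (insert (?t1, 5::nat) (insert (?t2, 1::nat) {}))"
  have c1: "linked ?M1 ?U1" by (rule linked_leaf3[OF c0]) (simp_all add: edge_simps)
  let ?M2 = "insert ?t3 (insert ?t4 ?M1)"
  let ?U2 = "insert (?t1, 3::nat) (insert (?t3, 0::nat) (insert (?t4, 0::nat) ?U1))"
  have c2: "linked ?M2 ?U2" by (rule linked_leaf3[OF c1]) (simp_all add: edge_simps)
  have T: "trees 3 = ?M2" by (auto simp: trees_simps)
  show ?thesis unfolding linkable_def T
    by (rule exI, rule conjI, rule c2) (simp add: chain_3)
qed

text \<open>\<open>chain 3\<close> stays alone. A 6-cycle lowers the number of components by two, so
  the other four cycles are glued by one 8-cycle, which lowers it by three.\<close>

lemma bilinkable_3: "bilinkable 3"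
proof -
  let ?t0 = "Nd (Nd Lf Lf) (Nd Lf Lf)"
  let ?t1 = "Nd Lf (Nd (Nd Lf Lf) Lf)"
  let ?t2 = "Nd (Nd Lf (Nd Lf Lf)) Lf"
  let ?t3 = "Nd (Nd (Nd Lf Lf) Lf) Lf"
  have c0: "linked {?t0} {}" by (rule linked_single)
  let ?M1 = "insert ?t1 (insert ?t2 (insert ?t3 {?t0}))"
  let ?U1 = "insert (?t0, 2::nat) (insert (?t1, 0::nat) (insert (?t2, 0::nat) (insert (?t3, 4::nat) {})))"
  have c1: "linked ?M1 ?U1" by (rule linked_leaf4[OF c0]) (simp_all add: edge_simps)
  have T: "{Nd Lf (Nd Lf (Nd Lf Lf))} \<union> ?M1 = trees 3" by (auto simp: trees_simps)
  show ?thesis unfolding bilinkable_def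
    by (rule exI, rule exI, rule exI, rule conjI, rule T, rule conjI[rotated], rule conjI, rule linked_single,
      rule conjI, rule c1) (simp_all add: chain_3 hook_def chain_2)
qed

text \<open>Of the 14 cycles, an 8-cycle glues four, which settles the parity, and five 6-cycles add
  the rest. \<open>chain 4\<close> is opened at positions 3 and 4 only.\<close>

lemma linkable_4: "linkable 4"
proof -
  let ?t0 = "Nd Lf (Nd Lf (Nd Lf (Nd Lf Lf)))"
  let ?t1 = "Nd Lf (Nd (Nd (Nd Lf Lf) Lf) Lf)"
  let ?t2 = "Nd (Nd (Nd Lf Lf) (Nd Lf Lf)) Lf"
  let ?t3 = "Nd Lf (Nd Lf (Nd (Nd Lf Lf) Lf))"
  let ?t4 = "Nd (Nd (Nd Lf Lf) Lf) (Nd Lf Lf)"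
  let ?t5 = "Nd (Nd Lf Lf) (Nd Lf (Nd Lf Lf))"
  let ?t6 = "Nd Lf (Nd (Nd Lf Lf) (Nd Lf Lf))"
  let ?t7 = "Nd (Nd Lf (Nd Lf Lf)) (Nd Lf Lf)"
  let ?t8 = "Nd (Nd Lf (Nd (Nd Lf Lf) Lf)) Lf"
  let ?t9 = "Nd (Nd (Nd Lf (Nd Lf Lf)) Lf) Lf"
  let ?t10 = "Nd (Nd (Nd (Nd Lf Lf) Lf) Lf) Lf"
  let ?t11 = "Nd Lf (Nd (Nd Lf (Nd Lf Lf)) Lf)"
  let ?t12 = "Nd (Nd Lf Lf) (Nd (Nd Lf Lf) Lf)"
  let ?t13 = "Nd (Nd Lf (Nd Lf (Nd Lf Lf))) Lf"
  have c0: "linked {?t0} {}" by (rule linked_single)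
  let ?M1 = "insert ?t1 (insert ?t2 (insert ?t3 {?t0}))"
  let ?U1 = "insert (?t0, 3::nat) (insert (?t1, 1::nat) (insert (?t2, 0::nat) (insert (?t3, 6::nat) {})))"
  have c1: "linked ?M1 ?U1" by (rule linked_leaf4[OF c0]) (simp_all add: edge_simps)
  let ?M2 = "insert ?t4 (insert ?t5 ?M1)"
  let ?U2 = "insert (?t0, 4::nat) (insert (?t4, 5::nat) (insert (?t5, 1::nat) ?U1))"
  have c2: "linked ?M2 ?U2" by (rule linked_leaf3[OF c1]) (simp_all add: edge_simps)
  let ?M3 = "insert ?t6 (insert ?t7 ?M2)"
  let ?U3 = "insert (?t4, 1::nat) (insert (?t6, 4::nat) (insert (?t7, 5::nat) ?U2))"
  have c3: "linked ?M3 ?U3" by (rule linked_leaf3[OF c2]) (simp_all add: edge_simps)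
  let ?M4 = "insert ?t8 (insert ?t9 ?M3)"
  let ?U4 = "insert (?t4, 7::nat) (insert (?t8, 7::nat) (insert (?t9, 4::nat) ?U3))"
  have c4: "linked ?M4 ?U4" by (rule linked_leaf3[OF c3]) (simp_all add: edge_simps)
  let ?M5 = "insert ?t10 (insert ?t11 ?M4)"
  let ?U5 = "insert (?t6, 1::nat) (insert (?t10, 0::nat) (insert (?t11, 4::nat) ?U4))"
  have c5: "linked ?M5 ?U5" by (rule linked_leaf3[OF c4]) (simp_all add: edge_simps)
  let ?M6 = "insert ?t12 (insert ?t13 ?M5)"
  let ?U6 = "insert (?t9, 2::nat) (insert (?t12, 6::nat) (insert (?t13, 7::nat) ?U5))"
  have c6: "linked ?M6 ?U6" by (rule linked_leaf3[OF c5]) (simp_all add: edge_simps)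
  have T: "trees 4 = ?M6" by (auto simp: trees_simps)
  show ?thesis unfolding linkable_def T
    by (rule exI, rule conjI, rule c6) (simp add: chain_4)
qed

text \<open>\<open>chain 4\<close> stays alone and six 6-cycles glue the other 13 cycles;
  \<open>hook 4\<close>, which is \<open>?t0\<close>, is opened only at position 5.\<close>

lemma bilinkable_4: "bilinkable 4"
proof -
  let ?t0 = "Nd (Nd Lf Lf) (Nd Lf (Nd Lf Lf))"
  let ?t1 = "Nd (Nd Lf (Nd Lf Lf)) (Nd Lf Lf)"
  let ?t2 = "Nd (Nd (Nd Lf Lf) Lf) (Nd Lf Lf)"
  let ?t3 = "Nd (Nd (Nd Lf Lf) (Nd Lf Lf)) Lf"
  let ?t4 = "Nd (Nd (Nd (Nd Lf Lf) Lf) Lf) Lf"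
  let ?t5 = "Nd (Nd Lf (Nd (Nd Lf Lf) Lf)) Lf"
  let ?t6 = "Nd (Nd (Nd Lf (Nd Lf Lf)) Lf) Lf"
  let ?t7 = "Nd (Nd Lf Lf) (Nd (Nd Lf Lf) Lf)"
  let ?t8 = "Nd (Nd Lf (Nd Lf (Nd Lf Lf))) Lf"
  let ?t9 = "Nd Lf (Nd (Nd (Nd Lf Lf) Lf) Lf)"
  let ?t10 = "Nd Lf (Nd Lf (Nd (Nd Lf Lf) Lf))"
  let ?t11 = "Nd Lf (Nd (Nd Lf Lf) (Nd Lf Lf))"
  let ?t12 = "Nd Lf (Nd (Nd Lf (Nd Lf Lf)) Lf)"
  have c0: "linked {?t0} {}" by (rule linked_single)
  let ?M1 = "insert ?t1 (insert ?t2 {?t0})"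
  let ?U1 = "insert (?t0, 5::nat) (insert (?t1, 5::nat) (insert (?t2, 2::nat) {}))"
  have c1: "linked ?M1 ?U1" by (rule linked_leaf3[OF c0]) (simp_all add: edge_simps)
  let ?M2 = "insert ?t3 (insert ?t4 ?M1)"
  let ?U2 = "insert (?t1, 7::nat) (insert (?t3, 7::nat) (insert (?t4, 4::nat) ?U1))"
  have c2: "linked ?M2 ?U2" by (rule linked_leaf3[OF c1]) (simp_all add: edge_simps)
  let ?M3 = "insert ?t5 (insert ?t6 ?M2)"
  let ?U3 = "insert (?t2, 7::nat) (insert (?t5, 7::nat) (insert (?t6, 4::nat) ?U2))"
  have c3: "linked ?M3 ?U3" by (rule linked_leaf3[OF c2]) (simp_all add: edge_simps)
  let ?M4 = "insert ?t7 (insert ?t8 ?M3)"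
  let ?U4 = "insert (?t6, 2::nat) (insert (?t7, 6::nat) (insert (?t8, 7::nat) ?U3))"
  have c4: "linked ?M4 ?U4" by (rule linked_leaf3[OF c3]) (simp_all add: edge_simps)
  let ?M5 = "insert ?t9 (insert ?t10 ?M4)"
  let ?U5 = "insert (?t5, 0::nat) (insert (?t9, 5::nat) (insert (?t10, 1::nat) ?U4))"
  have c5: "linked ?M5 ?U5" by (rule linked_leaf3[OF c4]) (simp_all add: edge_simps)
  let ?M6 = "insert ?t11 (insert ?t12 ?M5)"
  let ?U6 = "insert (?t9, 4::nat) (insert (?t11, 7::nat) (insert (?t12, 7::nat) ?U5))"
  have c6: "linked ?M6 ?U6" by (rule linked_leaf3[OF c5]) (simp_all add: edge_simps)
  have T: "{Nd Lf (Nd Lf (Nd Lf (Nd Lf Lf)))} \<union> ?M6 = trees 4" by (auto simp: trees_simps)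
  show ?thesis unfolding bilinkable_def
    by (rule exI, rule exI, rule exI, rule conjI, rule T, rule conjI[rotated], rule conjI, rule linked_single,
      rule conjI, rule c6) (simp_all add: chain_4 hook_def chain_2)
qed

section \<open>Attaching further classes\<close>

definition class_used :: "nat \<Rightarrow> nat \<Rightarrow> tedge set \<Rightarrow> tedge set" where
  "class_used a b V = {(Nd w v, j) | w v j. w \<in> trees a \<and> v \<in> trees b \<and>
     (1 \<le> j \<and> j \<le> 2 * a \<and> (w, j - 1) \<in> V \<or> 2 * a + 2 \<le> j)}"

text \<open>The coarser bound forgets the chosen \<open>v\<close> and gives up the right blocks
  entirely, but still controls the left blocks and excludes the seams.\<close>

lemma nodes_used_class_used:
  "F \<subseteq> trees b \<Longrightarrow> nodes_used (trees a) F v V W \<subseteq> class_used a b V"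
  unfolding nodes_used_def class_used_def trees_def by blast

lemma chain_trees: "chain b \<in> trees b"
  by (simp add: trees_def)

text \<open>The trees of size 2 cannot be glued to each other, so for \<open>b = 2\<close> the two fibres are attached one by one.\<close>
lemma attach_class:
  fixes e :: "dtree \<Rightarrow> tedge"
  assumes M: "linked M U" and XY: "X \<union> Y = trees a" "X \<inter> Y = {}" "linked X V" "linked Y V"
    and b: "b \<noteq> 2 \<Longrightarrow> linkable b" and disj: "M \<inter> nodes (trees a) (trees b) = {}"
    and xy: "x \<in> X" "y \<in> Y" "i < 2 * sz y" "(y, i) \<notin> V"
    and e: "\<And>v. v \<in> trees b \<Longrightarrow> fst (e v) \<in> M \<and> valid_edge (e v) \<and> e v \<notin> U"
    and inj: "inj e"
    and feeds: "\<And>v. feeds (Nd y v, Suc i) (e v)" "\<And>v. feeds (e v) (Nd x v, 0)"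
      "\<And>v. feeds (Nd x v, 0) (Nd y v, Suc i)"
  shows "\<exists>U'. linked (M \<union> nodes (trees a) (trees b)) U' \<and>
    U' \<subseteq> U \<union> range e \<union> range (\<lambda>v. (Nd y v, Suc i)) \<union> range (\<lambda>v. (Nd x v, 0)) \<union> class_used a b V"
proof (cases "b = 2")
  case False
  then obtain W where W: "linked (trees b) W" using b by (auto simp: linkable_def)
  have eZ: "fst (e (chain b)) \<in> M" "valid_edge (e (chain b))" "e (chain b) \<notin> U" using e[OF chain_trees] by blast+
  have "M \<inter> nodes (X \<union> Y) (trees b) = {}" unfolding XY(1) by (rule disj)
  then have c: "linked (M \<union> nodes (X \<union> Y) (trees b))
      (U \<union> {e (chain b), (Nd y (chain b), Suc i), (Nd x (chain b), 0)} \<union> nodes_used (X \<union> Y) (trees b) (chain b) V W)"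
    by (rule linked_attach[OF M XY(3,4,2) W chain_trees _ xy _ _ _ feeds]) (rule eZ)+
  have "nodes_used (X \<union> Y) (trees b) (chain b) V W \<subseteq> class_used a b V"
    unfolding XY(1) by (rule nodes_used_class_used) simp
  then have "U \<union> {e (chain b), (Nd y (chain b), Suc i), (Nd x (chain b), 0)} \<union> nodes_used (X \<union> Y) (trees b) (chain b) V W \<subseteq>
      U \<union> range e \<union> range (\<lambda>v. (Nd y v, Suc i)) \<union> range (\<lambda>v. (Nd x v, 0)) \<union> class_used a b V"
    by (intro Un_least) auto
  with c show ?thesis unfolding XY(1) by (intro exI conjI)
next
  case True
  let ?F1 = "{chain 2}" and ?F2 = "{hook 2}"
  have mem: "chain 2 \<in> trees b" "hook 2 \<in> trees b" using True trees_2 by auto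
  have ne: "chain 2 \<noteq> hook 2" by (simp add: chain_2 hook_def)
  have un: "nodes (trees a) (trees b) = nodes (trees a) ?F1 \<union> nodes (trees a) ?F2"
    unfolding True trees_2 by (auto simp: nodes_def)
  let ?U1 = "U \<union> {e (chain 2), (Nd y (chain 2), Suc i), (Nd x (chain 2), 0)} \<union> nodes_used (X \<union> Y) ?F1 (chain 2) V {}"
  let ?U2 = "?U1 \<union> {e (hook 2), (Nd y (hook 2), Suc i), (Nd x (hook 2), 0)} \<union> nodes_used (X \<union> Y) ?F2 (hook 2) V {}"
  have "M \<inter> nodes (X \<union> Y) ?F1 = {}" using disj unfolding XY(1) un by blast
  moreover have "fst (e (chain 2)) \<in> M" "valid_edge (e (chain 2))" "e (chain 2) \<notin> U" using e[OF mem(1)] by blast+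
  ultimately have 1: "linked (M \<union> nodes (X \<union> Y) ?F1) ?U1"
    by (rule linked_attach[OF M XY(3,4,2) linked_single singletonI _ xy _ _ _ feeds])
  have d2: "(M \<union> nodes (X \<union> Y) ?F1) \<inter> nodes (X \<union> Y) ?F2 = {}"
  proof -
    have "nodes (X \<union> Y) ?F1 \<inter> nodes (X \<union> Y) ?F2 = {}" using ne by (auto simp: nodes_def)
    then show ?thesis using disj unfolding XY(1) un by blast
  qed
  have fst: "fst f \<in> nodes (trees a) (trees b)"
    if "f \<in> {(Nd y (chain 2), Suc i), (Nd x (chain 2), 0)} \<union> nodes_used (X \<union> Y) ?F1 (chain 2) V {}" for f
  proof -
    have "x \<in> trees a" "y \<in> trees a" using xy(1,2) XY(1) by blast+
    then have "Nd x (chain 2) \<in> nodes (trees a) ?F1" "Nd y (chain 2) \<in> nodes (trees a) ?F1"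
      unfolding nodes_def by blast+
    moreover have "f = (Nd y (chain 2), Suc i) \<or> f = (Nd x (chain 2), 0) \<or> fst f \<in> nodes (trees a) ?F1"
      using that fst_nodes_used[of f "X \<union> Y" ?F1 "chain 2" V "{}"] unfolding XY(1) by blast
    ultimately show ?thesis unfolding un by auto
  qed
  have nin: "fst (e (hook 2)) \<notin> nodes (trees a) (trees b)" using e[OF mem(2)] disj by blast
  \<comment> \<open>Injectivity of \<open>e\<close> provides the second fibre with an edge of
    \<open>M\<close> that the first one has not opened.\<close>
  have "e (hook 2) \<noteq> e (chain 2)" using inj ne by (metis injD)
  then have "e (hook 2) \<notin> ?U1" using e[OF mem(2)] nin fst[of "e (hook 2)"] by blast
  moreover have "fst (e (hook 2)) \<in> M \<union> nodes (X \<union> Y) ?F1" "valid_edge (e (hook 2))" using e[OF mem(2)] by blast+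
  ultimately have "linked (M \<union> nodes (X \<union> Y) ?F1 \<union> nodes (X \<union> Y) ?F2) ?U2"
    by (intro linked_attach[OF 1 XY(3,4,2) linked_single singletonI d2 xy _ _ _ feeds])
  then have c: "linked (M \<union> nodes (trees a) (trees b)) ?U2" unfolding XY(1) un by (simp only: Un_assoc)
  have "nodes_used (X \<union> Y) ?F1 (chain 2) V {} \<subseteq> class_used a b V" "nodes_used (X \<union> Y) ?F2 (hook 2) V {} \<subseteq> class_used a b V"
    unfolding XY(1) by (rule nodes_used_class_used, use mem in simp)+
  then have "?U2 \<subseteq> U \<union> range e \<union> range (\<lambda>v. (Nd y v, Suc i)) \<union> range (\<lambda>v. (Nd x v, 0)) \<union> class_used a b V"
    by (intro Un_least) auto
  with c show ?thesis by (intro exI conjI)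
qed

lemma attach_bilinkable:
  assumes M: "linked M U" and d: "1 \<le> d" "bilinkable (Suc d)" and b: "b \<noteq> 2 \<Longrightarrow> linkable b"
    and disj: "M \<inter> nodes (trees (Suc d)) (trees b) = {}"
    and e: "\<And>v. v \<in> trees b \<Longrightarrow> Nd (chain d) (Nd Lf v) \<in> M" "\<And>v. (Nd (chain d) v, 1) \<notin> U"
    and e': "\<And>v. (Nd (chain (Suc d)) v, 1) \<notin> U"
  shows "\<exists>U'. linked (M \<union> nodes (trees (Suc d)) (trees b)) U' \<and> (\<forall>v. (Nd (chain (Suc d)) v, 1) \<notin> U') \<and>
    (\<forall>f\<in>U'. f \<in> U \<or> (\<exists>v. f = (Nd (chain d) v, 1)) \<or> (\<exists>w v j. sz w = Suc d \<and> f = (Nd w v, j)))"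
proof -
  obtain n where n: "d = Suc n" using d(1) by (cases d) auto
  from d(2) obtain X Y V where XY: "X \<union> Y = trees (Suc d)" "X \<inter> Y = {}" "linked X V" "linked Y V"
    and zx: "chain (Suc d) \<in> X" "hook (Suc d) \<in> Y" "(chain (Suc d), 0) \<notin> V" "(hook (Suc d), 3) \<notin> V"
    unfolding bilinkable_def by blast
  \<comment> \<open>Position 1 here is the left-block copy of edge 0 of
    \<open>chain d\<close>.\<close>
  let ?e = "\<lambda>v. (Nd (chain d) (Nd Lf v), 1::nat)"
  have sA: "sz (hook (Suc d)) = Suc d" using d(1) by (intro sz_hook) simp
  have "\<exists>U'. linked (M \<union> nodes (trees (Suc d)) (trees b)) U' \<and>
    U' \<subseteq> U \<union> range ?e \<union> range (\<lambda>v. (Nd (hook (Suc d)) v, Suc 3)) \<union> range (\<lambda>v. (Nd (chain (Suc d)) v, 0)) \<union> class_used (Suc d) b V"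
  proof (rule attach_class[OF M XY b disj zx(1,2)])
    show "3 < 2 * sz (hook (Suc d))" using d(1) sA by simp
    show "fst (?e v) \<in> M \<and> valid_edge (?e v) \<and> ?e v \<notin> U" if "v \<in> trees b" for v
      using e that by (simp add: valid_edge_def)
    show "inj ?e" by (simp add: inj_def)
    show "feeds (Nd (hook (Suc d)) v, Suc 3) (?e v)" "feeds (?e v) (Nd (chain (Suc d)) v, 0)"
      "feeds (Nd (chain (Suc d)) v, 0) (Nd (hook (Suc d)) v, Suc 3)" for v
      using feeds_class[of n v] unfolding n by simp_all
  qed (use zx in simp_all)
  then obtain U' where U': "linked (M \<union> nodes (trees (Suc d)) (trees b)) U'"
    "U' \<subseteq> U \<union> range ?e \<union> range (\<lambda>v. (Nd (hook (Suc d)) v, Suc 3)) \<union> range (\<lambda>v. (Nd (chain (Suc d)) v, 0)) \<union> class_used (Suc d) b V"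
    by blast
  have "(Nd (chain (Suc d)) v, 1) \<notin> U'" for v
  proof
    assume "(Nd (chain (Suc d)) v, 1) \<in> U'"
    then show False using U'(2) e' zx(3) by (auto simp: class_used_def)
  qed
  moreover have "f \<in> U \<or> (\<exists>v. f = (Nd (chain d) v, 1)) \<or> (\<exists>w v j. sz w = Suc d \<and> f = (Nd w v, j))"
    if "f \<in> U'" for f
    using that U'(2) sA by (auto simp: class_used_def trees_def)
  ultimately show ?thesis using U'(1) by blast
qed

text \<open>Iteration of \<open>attach_bilinkable\<close>. The description of the opened edges is
  part of the invariant, since trees of left size at most \<open>c\<close> may be opened further
  only at position 1 over a chain.\<close>

lemma attach_classes:
  assumes "c \<le> d" "d < m" and M: "linked M U" and c: "1 \<le> c"
    and bilinkable: "\<And>a. c < a \<Longrightarrow> a < m \<Longrightarrow> bilinkable a" and linkable: "\<And>b. b < m \<Longrightarrow> b \<noteq> 2 \<Longrightarrow> linkable b"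
    and sub: "nodes (trees c) (trees (m - 1 - c)) \<subseteq> M" and M': "\<And>w v. Nd w v \<in> M \<Longrightarrow> sz w \<le> c"
    and U: "\<And>w v j. (Nd w v, j) \<in> U \<Longrightarrow> sz w \<le> c" "\<And>v. (Nd (chain c) v, 1) \<notin> U"
  shows "\<exists>U'. linked (M \<union> (\<Union>a\<in>{c<..d}. nodes (trees a) (trees (m - 1 - a)))) U' \<and>
    (\<forall>v. (Nd (chain d) v, 1) \<notin> U') \<and>
    (\<forall>f\<in>U'. f \<in> U \<or> (\<exists>a v. c \<le> a \<and> a < d \<and> f = (Nd (chain a) v, 1)) \<or>
      (\<exists>w v j. c < sz w \<and> sz w \<le> d \<and> f = (Nd w v, j)))"
  using assms(1,2)
proof (induction d rule: dec_induct)
  case base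
  then show ?case using M U by (intro exI[of _ U]) auto
next
  case (step d)
  let ?M = "M \<union> (\<Union>a\<in>{c<..d}. nodes (trees a) (trees (m - 1 - a)))"
  let ?b = "m - 1 - Suc d"
  have "d < m" using step.prems by simp
  from step.IH[OF this] obtain U' where U': "linked ?M U'" "\<And>v. (Nd (chain d) v, 1) \<notin> U'"
    "\<And>f. f \<in> U' \<Longrightarrow> f \<in> U \<or> (\<exists>a v. c \<le> a \<and> a < d \<and> f = (Nd (chain a) v, 1)) \<or>
      (\<exists>w v j. c < sz w \<and> sz w \<le> d \<and> f = (Nd w v, j))" by blast
  have U'sz: "sz w \<le> d" if "(Nd w v, j) \<in> U'" for w v j
    using U'(3)[OF that] U(1)[of w v j] step.hyps by auto
  have "\<exists>U''. linked (?M \<union> nodes (trees (Suc d)) (trees ?b)) U'' \<and> (\<forall>v. (Nd (chain (Suc d)) v, 1) \<notin> U'') \<and>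
    (\<forall>f\<in>U''. f \<in> U' \<or> (\<exists>v. f = (Nd (chain d) v, 1)) \<or> (\<exists>w v j. sz w = Suc d \<and> f = (Nd w v, j)))"
  proof (rule attach_bilinkable[OF U'(1)])
    show "1 \<le> d" using c step.hyps by simp
    show "bilinkable (Suc d)" using bilinkable step by simp
    show "linkable ?b" if "?b \<noteq> 2" using linkable that step.prems by simp
    show "?M \<inter> nodes (trees (Suc d)) (trees ?b) = {}"
      using M' step.hyps by (fastforce simp: nodes_def trees_def)
    show "Nd (chain d) (Nd Lf v) \<in> ?M" if "v \<in> trees ?b" for v
    proof -
      \<comment> \<open>\<open>Nd Lf v\<close> is larger than \<open>v\<close> by one, which puts
        this tree in the preceding class.\<close>
      have *: "Nd (chain d) (Nd Lf v) \<in> nodes (trees d) (trees (m - 1 - d))"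
        using that step.prems by (auto simp: nodes_def trees_def)
      show ?thesis
      proof (cases "d = c")
        case True
        then show ?thesis using * sub by blast
      next
        case False
        then have "d \<in> {c<..d}" using step.hyps by simp
        then show ?thesis using * by blast
      qed
    qed
    show "(Nd (chain (Suc d)) v, 1) \<notin> U'" for v using U'sz[of "chain (Suc d)" v 1] by auto
  qed (rule U')
  then obtain U'' where U'': "linked (?M \<union> nodes (trees (Suc d)) (trees ?b)) U''" "\<forall>v. (Nd (chain (Suc d)) v, 1) \<notin> U''"
    "\<And>f. f \<in> U'' \<Longrightarrow> f \<in> U' \<or> (\<exists>v. f = (Nd (chain d) v, 1)) \<or> (\<exists>w v j. sz w = Suc d \<and> f = (Nd w v, j))"
    by blast
  have "{c<..Suc d} = insert (Suc d) {c<..d}" using step.hyps by auto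
  then have eq: "?M \<union> nodes (trees (Suc d)) (trees ?b) =
      M \<union> (\<Union>a\<in>{c<..Suc d}. nodes (trees a) (trees (m - 1 - a)))" by auto
  have "f \<in> U \<or> (\<exists>a v. c \<le> a \<and> a < Suc d \<and> f = (Nd (chain a) v, 1)) \<or>
      (\<exists>w v j. c < sz w \<and> sz w \<le> Suc d \<and> f = (Nd w v, j))" if "f \<in> U''" for f
  proof -
    consider "f \<in> U'" | v where "f = (Nd (chain d) v, 1)" | w v j where "sz w = Suc d" "f = (Nd w v, j)"
      using U''(3)[OF \<open>f \<in> U''\<close>] by blast
    then show ?thesis
    proof cases
      case 1
      from U'(3)[OF this] show ?thesis by fastforce
    next
      case 2
      then show ?thesis using step.hyps by blast
    next
      case 3
      then show ?thesis using step.hyps by (metis le_imp_less_Suc order_refl)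
    qed
  qed
  then show ?case using U''(1,2) unfolding eq by blast
qed

section \<open>The induction step\<close>

lemma trees_split:
  assumes "c < m"
  shows "trees m = (\<Union>a\<in>{..c}. nodes (trees a) (trees (m - 1 - a))) \<union>
    (\<Union>a\<in>{c<..m - 1}. nodes (trees a) (trees (m - 1 - a)))"
proof -
  have "{..m - 1} = {..c} \<union> {c<..m - 1}" using assms by auto
  moreover have "trees m = (\<Union>a\<in>{..m - 1}. nodes (trees a) (trees (m - 1 - a)))"
    using trees_Suc[of "m - 1"] assms by simp
  ultimately show ?thesis by (simp add: UN_Un)
qed

text \<open>The class of left size 0, which contains \<open>chain m\<close>, is one component. All
  other classes are attached in turn to the class of left size 1, which contains
  \<open>hook m\<close>.\<close>

lemma bilinkable_step:
  assumes m: "5 \<le> m" and bilinkable: "\<And>a. 2 \<le> a \<Longrightarrow> a < m \<Longrightarrow> bilinkable a"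
    and linkable: "\<And>b. b < m \<Longrightarrow> b \<noteq> 2 \<Longrightarrow> linkable b"
  shows "bilinkable m"
proof -
  let ?K = "\<lambda>a. nodes (trees a) (trees (m - 1 - a))"
  have "linkable (m - 1)" "linkable (m - 2)" using linkable m by simp_all
  then obtain W0 W1 where W0: "linked (trees (m - 1)) W0" and W1: "linked (trees (m - 2)) W1"
    unfolding linkable_def by blast
  let ?U0 = "nodes_used {Lf} (trees (m - 1)) (chain (m - 1)) {} W0"
  let ?U1 = "nodes_used {Nd Lf Lf} (trees (m - 2)) (chain (m - 2)) {} W1"
  have X: "linked (?K 0) ?U0" using linked_nodes_used[OF linked_single W0 chain_trees] by (simp add: trees_0)
  have K1: "linked (?K 1) ?U1"
    using linked_nodes_used[OF linked_single W1 chain_trees, of "Nd Lf Lf" "{}"] by (simp add: trees_1 numeral_2_eq_2)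
  have "\<exists>U. linked (?K 1 \<union> (\<Union>a\<in>{1<..m - 1}. ?K a)) U \<and> (\<forall>v. (Nd (chain (m - 1)) v, 1) \<notin> U) \<and>
    (\<forall>f\<in>U. f \<in> ?U1 \<or> (\<exists>a v. 1 \<le> a \<and> a < m - 1 \<and> f = (Nd (chain a) v, 1)) \<or>
      (\<exists>w v j. 1 < sz w \<and> sz w \<le> m - 1 \<and> f = (Nd w v, j)))"
    by (rule attach_classes[OF _ _ K1]) (use m bilinkable linkable in \<open>auto simp: nodes_def trees_def\<close>)
  then obtain U where U: "linked (?K 1 \<union> (\<Union>a\<in>{1<..m - 1}. ?K a)) U"
    "\<And>f. f \<in> U \<Longrightarrow> f \<in> ?U1 \<or> (\<exists>a v. 1 \<le> a \<and> a < m - 1 \<and> f = (Nd (chain a) v, 1)) \<or>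
      (\<exists>w v j. 1 < sz w \<and> sz w \<le> m - 1 \<and> f = (Nd w v, j))" by blast
  have chain_m: "chain m = Nd Lf (chain (m - 1))" using m by (cases m) auto
  have hook_m: "hook m = Nd (Nd Lf Lf) (chain (m - 2))" by (simp add: hook_def)
  have "?K 0 \<union> (?K 1 \<union> (\<Union>a\<in>{1<..m - 1}. ?K a)) = trees m"
    using trees_split[of 1 m] m by (simp add: atMost_Suc Un_ac)
  moreover have "?K 0 \<inter> (?K 1 \<union> (\<Union>a\<in>{1<..m - 1}. ?K a)) = {}"
    by (auto simp: nodes_def trees_def)
  moreover have "linked (?K 0) (?U0 \<union> U)" "linked (?K 1 \<union> (\<Union>a\<in>{1<..m - 1}. ?K a)) (?U0 \<union> U)"
    using linked_mono[OF X] linked_mono[OF U(1)] by auto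
  moreover have "chain m \<in> ?K 0" unfolding chain_m by (auto simp: nodes_def trees_def)
  moreover have "hook m \<in> ?K 1 \<union> (\<Union>a\<in>{1<..m - 1}. ?K a)" unfolding hook_m using m by (auto simp: nodes_def trees_def)
  \<comment> \<open>Both edges are seams, which \<open>nodes_used\<close> never contains; attaching
    classes opens trees of left size 1 only at position 1.\<close>
  moreover have "(chain m, 0) \<notin> U" using U(2)[of "(chain m, 0)"] unfolding chain_m by auto
  moreover have "(hook m, 3) \<notin> U" using U(2)[of "(hook m, 3)"] unfolding hook_m by auto
  moreover have "(chain m, 0) \<notin> ?U0" "(hook m, 3) \<notin> ?U0" unfolding chain_m hook_m by auto
  ultimately show ?thesis unfolding bilinkable_def by (metis (no_types, lifting) Un_iff)
qed

text \<open>Left size 2 enters as two components, left sizes 0, 1 and 3 as one each, so two 6-cycles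
  suffice: \<open>feeds_class2\<close> joins sizes 0 and 2, and \<open>feeds_class1_class3\<close>
  adds sizes 1 and 3. Only \<open>m = 6\<close> requires one more.\<close>

lemma linked_small_classes:
  assumes m: "5 \<le> m" and linkable: "\<And>b. b < m \<Longrightarrow> b \<noteq> 2 \<Longrightarrow> linkable b" and bilinkable3: "bilinkable 3"
  defines "K \<equiv> \<lambda>a. nodes (trees a) (trees (m - 1 - a))"
  shows "\<exists>U. linked (K 0 \<union> K 1 \<union> K 2 \<union> K 3) U \<and> (\<forall>v. (Nd (chain 3) v, 1) \<notin> U) \<and> (chain m, 0) \<notin> U \<and> (chain m, 2) \<notin> U"
proof -
  let ?E = "Nd Lf Lf" and ?v = "chain (m - 4)"
  have "linkable (m - 1)" "linkable (m - 2)" "linkable 3" using linkable m by simp_all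
  then obtain W0 W1 V3 where W0: "linked (trees (m - 1)) W0" "(chain (m - 1), 0) \<notin> W0"
    and W1: "linked (trees (m - 2)) W1" "(chain (m - 2), 2) \<notin> W1"
    and V3: "linked (trees 3) V3" "(chain 3, 0) \<notin> V3" unfolding linkable_def by blast
  have chain_m: "chain m = Nd Lf (chain (m - 1))" "chain (m - 1) = Nd Lf (chain (m - 2))" "chain (m - 2) = Nd Lf (Nd Lf ?v)"
  proof -
    have "m = Suc (m - 1)" "m - 1 = Suc (m - 2)" "m - 2 = Suc (Suc (m - 4))" using m by simp_all
    then show "chain m = Nd Lf (chain (m - 1))" "chain (m - 1) = Nd Lf (chain (m - 2))" "chain (m - 2) = Nd Lf (Nd Lf ?v)"
      by (metis chain.simps(2))+
  qed
  have szA: "sz (hook 2) = 2" "sz (hook 3) = 3" by (simp_all add: hook_def)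
  have neA: "hook 2 \<noteq> Lf" "hook 2 \<noteq> chain 2" "chain 2 \<noteq> Lf" "chain 3 \<noteq> Lf" "hook 2 \<noteq> ?E"
    by (simp_all add: hook_def chain_2 chain_3)
  define U0 where "U0 = nodes_used {Lf} (trees (m - 1)) (chain (m - 1)) {} W0"
  define U1 where "U1 = nodes_used {?E} (trees (m - 2)) (chain (m - 2)) {} W1"
  have K0: "linked (K 0) U0"
    using linked_nodes_used[OF linked_single W0(1) chain_trees] by (simp add: trees_0 K_def U0_def)
  have K1: "linked (K 1) U1"
    using linked_nodes_used[OF linked_single W1(1) chain_trees, of ?E "{}"] by (simp add: trees_1 numeral_2_eq_2 K_def U1_def)
  have disj: "K a \<inter> nodes (trees b) F = {}" if "a \<noteq> b" for a b F
    unfolding K_def using that by (rule nodes_disjoint)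
  let ?e = "\<lambda>v. (Nd Lf (Nd ?E v), 0::nat)"
  have "\<exists>U'. linked (K 0 \<union> nodes (trees 2) (trees (m - 3))) U' \<and>
    U' \<subseteq> U0 \<union> range ?e \<union> range (\<lambda>v. (Nd (hook 2) v, Suc 2)) \<union> range (\<lambda>v. (Nd (chain 2) v, 0)) \<union> class_used 2 (m - 3) {}"
  proof (rule attach_class[OF K0, of "{chain 2}" "{hook 2}"])
    show "{chain 2} \<union> {hook 2} = trees 2" by (simp add: trees_2 insert_commute)
    show "{chain 2} \<inter> {hook 2} = {}" using neA by simp
    show "linkable (m - 3)" if "m - 3 \<noteq> 2" using linkable that m by simp
    show "K 0 \<inter> nodes (trees 2) (trees (m - 3)) = {}" by (rule disj) simp
    show "2 < 2 * sz (hook 2)" by (simp add: szA)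
    show "fst (?e v) \<in> K 0 \<and> valid_edge (?e v) \<and> ?e v \<notin> U0" if "v \<in> trees (m - 3)" for v
      using that m by (auto simp: K_def nodes_def trees_def valid_edge_def U0_def)
    show "inj ?e" by (simp add: inj_def)
    show "feeds (Nd (hook 2) v, Suc 2) (?e v)" "feeds (?e v) (Nd (chain 2) v, 0)"
      "feeds (Nd (chain 2) v, 0) (Nd (hook 2) v, Suc 2)" for v
      using feeds_class2[of v] by simp_all
  qed (auto intro: linked_single)
  then obtain U2 where U2: "linked (K 0 \<union> K 2) U2"
    "U2 \<subseteq> U0 \<union> range ?e \<union> range (\<lambda>v. (Nd (hook 2) v, Suc 2)) \<union> range (\<lambda>v. (Nd (chain 2) v, 0)) \<union> class_used 2 (m - 3) {}"
    unfolding K_def by (auto simp: numeral_3_eq_3 numeral_2_eq_2)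
  \<comment> \<open>For \<open>m = 6\<close> the right subtrees at left size 3 have size 2 and
    cannot be glued. Then only the fibre over \<open>chain 2\<close> takes part now; the one over
    \<open>hook 2\<close> is attached at the end.\<close>
  define F where "F = (if m - 4 = 2 then {chain 2} else trees (m - 4))"
  have v: "?v \<in> F" unfolding F_def by (simp add: chain_trees)
  have "\<exists>W. linked F W"
  proof (cases "m - 4 = 2")
    case True
    then show ?thesis unfolding F_def by (auto intro: linked_single)
  next
    case False
    then have "linkable (m - 4)" using linkable m by simp
    then show ?thesis unfolding F_def linkable_def using False by auto
  qed
  then obtain W3 where W3: "linked F W3" by blast
  define U3 where "U3 = nodes_used (trees 3) F ?v V3 W3"
  have K3: "linked (nodes (trees 3) F) U3" unfolding U3_def by (rule linked_nodes_used[OF V3(1) W3 v])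
  let ?e1 = "(Nd (hook 2) (Nd Lf ?v), 2::nat)" and ?e2 = "(Nd (hook 3) ?v, 7::nat)"
    and ?e3 = "(Nd ?E (Nd Lf (Nd Lf ?v)), 6::nat)"
  let ?U = "insert ?e1 U2 \<union> insert ?e3 U1 \<union> insert ?e2 U3"
  have c3: "linked ((K 0 \<union> K 2) \<union> K 1 \<union> nodes (trees 3) F) ?U"
  proof (rule linked_glue3[OF U2(1) K1 K3])
    show "(K 0 \<union> K 2) \<inter> K 1 = {}" by (auto simp: K_def nodes_def trees_def)
    show "(K 0 \<union> K 2) \<inter> nodes (trees 3) F = {}" "K 1 \<inter> nodes (trees 3) F = {}"
      using disj[of 0 3 F] disj[of 2 3 F] disj[of 1 3 F] by auto
    show "fst ?e1 \<in> K 0 \<union> K 2" using m by (auto simp: K_def nodes_def trees_def szA)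
    show "fst ?e3 \<in> K 1" using m by (auto simp: K_def nodes_def trees_def)
    show "fst ?e2 \<in> nodes (trees 3) F" using v by (auto simp: nodes_def trees_def szA)
    show "valid_edge ?e1" "valid_edge ?e2" "valid_edge ?e3" by (simp_all add: valid_edge_def szA)
    show "?e1 \<notin> U2" using U2(2) neA by (auto simp: U0_def class_used_def)
    show "?e2 \<notin> U3" by (simp add: U3_def szA)
    show "?e3 \<notin> U1" using W1(2) by (simp add: U1_def chain_m)
  qed (use feeds_class1_class3[of ?v] in simp_all)
  have a3: "(Nd (chain 3) v', 1) \<notin> ?U" for v'
  proof -
    have "(Nd (chain 3) v', 1) \<notin> U2" using U2(2) neA by (auto simp: U0_def class_used_def trees_def)
    moreover have "(Nd (chain 3) v', 1) \<notin> U1" by (simp add: U1_def chain_3)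
    moreover have "(Nd (chain 3) v', 1) \<notin> U3" using V3(2) by (simp add: U3_def)
    ultimately show ?thesis by simp
  qed
  \<comment> \<open>Position 0 of \<open>chain m\<close> is a seam; position 2 is the copy of edge 0
    of \<open>chain (m - 1)\<close>, which \<open>W0\<close> avoids.\<close>
  have z: "(chain m, j) \<notin> ?U" if "j = 0 \<or> j = 2" for j
  proof -
    have "(chain m, j) \<notin> U0" using that W0(2) by (auto simp: U0_def chain_m(1))
    moreover have "chain m \<noteq> Nd Lf (Nd ?E v')" for v' unfolding chain_m(1,2) by simp
    then have "(chain m, j) \<notin> range ?e" by auto
    ultimately have "(chain m, j) \<notin> U2" using U2(2) neA by (auto simp: class_used_def trees_def chain_m(1))
    moreover have "(chain m, j) \<notin> U1" "(chain m, j) \<notin> U3" by (simp_all add: U1_def U3_def chain_m(1) trees_def)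
    ultimately show ?thesis using neA szA by (auto simp: chain_m(1))
  qed
  show ?thesis
  proof (cases "m - 4 = 2")
    case False
    then have "nodes (trees 3) F = K 3" unfolding F_def K_def by simp
    then have "(K 0 \<union> K 2) \<union> K 1 \<union> nodes (trees 3) F = K 0 \<union> K 1 \<union> K 2 \<union> K 3" by auto
    then show ?thesis using c3 a3 z by (metis (no_types, lifting))
  next
    case True
    then have m6: "m = 6" by simp
    from bilinkable3 obtain X Y V where XY: "X \<union> Y = trees 3" "X \<inter> Y = {}" "linked X V" "linked Y V"
      and zx: "chain 3 \<in> X" "hook 3 \<in> Y" "(chain 3, 0) \<notin> V" "(hook 3, 3) \<notin> V"
      unfolding bilinkable_def by blast
    \<comment> \<open>The fibre over \<open>hook 2\<close> is split by \<open>bilinkable 3\<close>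
      into two parts, and the 6-cycle of \<open>feeds_class\<close> with \<open>n = 1\<close>
      attaches both through this edge at left size 2.\<close>
    let ?f = "(Nd (chain 2) (Nd Lf (hook 2)), 1::nat)"
    let ?V = "?U \<union> {?f, (Nd (hook 3) (hook 2), Suc 3), (Nd (chain 3) (hook 2), 0)} \<union> nodes_used (X \<union> Y) {hook 2} (hook 2) V {}"
    have "linked (((K 0 \<union> K 2) \<union> K 1 \<union> nodes (trees 3) F) \<union> nodes (X \<union> Y) {hook 2}) ?V"
    proof (rule linked_attach[OF c3 XY(3,4,2) linked_single])
      show "((K 0 \<union> K 2) \<union> K 1 \<union> nodes (trees 3) F) \<inter> nodes (X \<union> Y) {hook 2} = {}"
        unfolding XY(1) F_def using True neA disj[of 0 3 "{hook 2}"] disj[of 2 3 "{hook 2}"] disj[of 1 3 "{hook 2}"]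
        by (auto simp: nodes_def)
      show "3 < 2 * sz (hook 3)" by (simp add: szA)
      show "fst ?f \<in> (K 0 \<union> K 2) \<union> K 1 \<union> nodes (trees 3) F"
        using m6 by (auto simp: K_def nodes_def trees_def szA)
      show "valid_edge ?f" by (simp add: valid_edge_def)
      have "?f \<notin> U2" using U2(2) neA by (auto simp: U0_def class_used_def)
      then show "?f \<notin> ?U" using neA by (auto simp: U1_def U3_def trees_def chain_2)
      have eq: "hook 3 = hook (Suc (Suc 1))" "chain 3 = chain (Suc (Suc 1))" "chain 2 = chain (Suc 1)" "Suc 3 = 4"
        by (simp_all add: numeral_3_eq_3 numeral_2_eq_2)
      show "feeds (Nd (hook 3) (hook 2), Suc 3) ?f" "feeds ?f (Nd (chain 3) (hook 2), 0)"
        "feeds (Nd (chain 3) (hook 2), 0) (Nd (hook 3) (hook 2), Suc 3)"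
        unfolding eq by (rule feeds_class(1), rule feeds_class(2), rule feeds_class(3))
    qed (use zx in simp_all)
    moreover have "nodes (trees 3) F \<union> nodes (X \<union> Y) {hook 2} = K 3"
      unfolding XY(1) F_def K_def using m6 trees_2 by (auto simp: nodes_def)
    then have "((K 0 \<union> K 2) \<union> K 1 \<union> nodes (trees 3) F) \<union> nodes (X \<union> Y) {hook 2} = K 0 \<union> K 1 \<union> K 2 \<union> K 3"
      by blast
    ultimately have "linked (K 0 \<union> K 1 \<union> K 2 \<union> K 3) ?V" by simp
    moreover have "(Nd (chain 3) v', 1) \<notin> ?V" for v'
      using a3[of v'] zx(3) by (auto simp: chain_2 chain_3)
    moreover have "(chain m, j) \<notin> ?V" if "j = 0 \<or> j = 2" for j
      using z[OF that] that XY(1) neA by (auto simp: chain_m(1) trees_def szA)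
    ultimately show ?thesis by blast
  qed
qed

lemma linkable_step:
  assumes m: "5 \<le> m" and bilinkable: "\<And>a. 2 \<le> a \<Longrightarrow> a < m \<Longrightarrow> bilinkable a"
    and linkable: "\<And>b. b < m \<Longrightarrow> b \<noteq> 2 \<Longrightarrow> linkable b"
  shows "linkable m"
proof -
  let ?K = "\<lambda>a. nodes (trees a) (trees (m - 1 - a))"
  let ?M = "?K 0 \<union> ?K 1 \<union> ?K 2 \<union> ?K 3"
  have "bilinkable 3" using bilinkable m by simp
  from linked_small_classes[OF m linkable this] obtain U where U: "linked ?M U" "\<And>v. (Nd (chain 3) v, 1) \<notin> U"
    "(chain m, 0) \<notin> U" "(chain m, 2) \<notin> U" by blast
  have Msz: "sz w \<le> 3" if "Nd w v \<in> ?M" for w v using that by (auto simp: nodes_def trees_def)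
  have "\<exists>U'. linked (?M \<union> (\<Union>a\<in>{3<..m - 1}. ?K a)) U' \<and> (\<forall>v. (Nd (chain (m - 1)) v, 1) \<notin> U') \<and>
    (\<forall>f\<in>U'. f \<in> U \<inter> edges_of ?M \<or> (\<exists>a v. 3 \<le> a \<and> a < m - 1 \<and> f = (Nd (chain a) v, 1)) \<or>
      (\<exists>w v j. 3 < sz w \<and> sz w \<le> m - 1 \<and> f = (Nd w v, j)))"
  \<comment> \<open>Restricting \<open>U\<close> to edges of the classes glued so far yields the
    bound 3 on left sizes that \<open>attach_classes\<close> asks for.\<close>
  proof (rule attach_classes[OF _ _ linked_path_edges_of(1)[OF U(1)]])
    show "sz w \<le> 3" if "(Nd w v, j) \<in> U \<inter> edges_of ?M" for w v j
      using that Msz[of w v] by (auto simp: edges_of_def)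
  qed (use m bilinkable linkable U Msz in \<open>auto\<close>)
  then obtain U' where U': "linked (?M \<union> (\<Union>a\<in>{3<..m - 1}. ?K a)) U'"
    "\<And>f. f \<in> U' \<Longrightarrow> f \<in> U \<inter> edges_of ?M \<or> (\<exists>a v. 3 \<le> a \<and> a < m - 1 \<and> f = (Nd (chain a) v, 1)) \<or>
      (\<exists>w v j. 3 < sz w \<and> sz w \<le> m - 1 \<and> f = (Nd w v, j))" by blast
  have 3: "{..3::nat} = {0, 1, 2, 3}" by auto
  have T: "trees m = (\<Union>a\<in>{..3}. ?K a) \<union> (\<Union>a\<in>{3<..m - 1}. ?K a)"
    by (rule trees_split) (use m in simp)
  have "?M \<union> (\<Union>a\<in>{3<..m - 1}. ?K a) = trees m" unfolding T 3 by blast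
  moreover have chain_m: "chain m = Nd Lf (chain (m - 1))" using m by (cases m) auto
  have "(chain m, 0) \<notin> U'" "(chain m, 2) \<notin> U'"
    using U'(2)[of "(chain m, 0)"] U'(2)[of "(chain m, 2)"] U(3,4) by (auto simp: chain_m)
  ultimately show ?thesis unfolding linkable_def using U'(1) by metis
qed

text \<open>The step for \<open>m\<close> glues right subtrees into one cycle and left subtrees into
  two, so both properties of the smaller sizes are carried along.\<close>

lemma linkable_bilinkable: "(m \<noteq> 2 \<longrightarrow> linkable m) \<and> (2 \<le> m \<longrightarrow> bilinkable m)"
proof (induction m rule: less_induct)
  case (less m)
  have "linkable 0" "linkable 1" unfolding linkable_def
    using linked_single[of Lf "{}"] linked_single[of "Nd Lf Lf" "{}"] by (auto simp: trees_0 trees_1)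
  consider "m = 0" | "m = 1" | "m = 2" | "m = 3" | "m = 4" | "5 \<le> m" by linarith
  then show ?case
  proof cases
    case 6
    then show ?thesis using linkable_step[of m] bilinkable_step[of m] less.IH by blast
  qed (use \<open>linkable 0\<close> \<open>linkable 1\<close> bilinkable_2 linkable_3 bilinkable_3 linkable_4 bilinkable_4 in simp_all)
qed

theorem theorem1:
  fixes k :: nat
  assumes "k \<ge> 3"
  shows "\<exists>p. pre_digraph.hamilton_cycle (with_proj (odd_graph k)) p"
proof -
  have "linkable k" using linkable_bilinkable[of k] assms by simp
  then obtain U where "linked (trees k) U" unfolding linkable_def by blast
  then show ?thesis using assms by (intro hamilton_cycle_of_linked) simp_all
qed

end
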